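(* Let $L$ be a Lie algebra over a field $\mathbb{k}$, let $X=\mathbb{k}\oplus L$ with comultiplication $\Delta$ and ternary operation $T$ as in the context, and let $R: X^{\otimes 2}\otimes X^{\otimes 2}\to X^{\otimes 2}\otimes X^{\otimes 2}$ be the linear map $$R(x\otimes y\otimes z\otimes w)= z^{(1)}\otimes w^{(1)}\otimes T(x\otimes z^{(2)}\otimes w^{(2)})\otimes T(y\otimes z^{(3)}\otimes w^{(3)}),\qquad x,y,z,w\in X.$$ Then $R$ satisfies the braid equation $$(R\otimes \mathbf 1)\circ(\mathbf 1\otimes R)\circ(R\otimes \mathbf 1)=(\mathbf 1\otimes R)\circ(R\otimes \mathbf 1)\circ(\mathbf 1\otimes R)$$ on $X^{\otimes 2}\otimes X^{\otimes 2}\otimes X^{\otimes 2}$, where $\mathbf 1$ is the identity of $X^{\otimes 2}$; i.e. $R$ is a pre-Yang-Baxter operator on $X^{\otimes 2}\otimes X^{\otimes 2}$.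
   Context: All tensor products are over $\mathbb{k}$. Elements of $X=\mathbb{k}\oplus L$ are written as pairs $(a,x)$ with $a\in\mathbb{k}$, $x\in L$. The coalgebra structure on $X$ is the linear maps $$\Delta(a,x)=(a,x)\otimes(1,0)+(1,0)\otimes(0,x),\qquad \epsilon(a,x)=a.$$ $\Delta_3=(\mathbf 1\otimes\Delta)\circ\Delta: X\to X^{\otimes 3}$ and Sweedler notation $\Delta_3(z)=z^{(1)}\otimes z^{(2)}\otimes z^{(3)}$ (sum understood) is used. The ternary operation $T:X\otimes X\otimes X\to X$ is the linear map $$T((a,x)\otimes(b,y)\otimes(c,z))=(abc,\ bcx+c[x,y]+b[x,z]+[[x,y],z]).$$ A pre-Yang-Baxter operator on $V\otimes V$ is a linear map $V\otimes V\to V\otimes V$ satisfying the braid equation; here $V=X^{\otimes 2}$. *)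

theory Defs
  imports "HOL-Algebra.Module" "HOL-Algebra.AbelCoset"
begin

section \<open>Linear and bilinear maps\<close>

definition linear_map ::
    "('k, 'r) ring_scheme \<Rightarrow> ('k, 'm, 's) module_scheme \<Rightarrow> ('k, 'n, 't) module_scheme
      \<Rightarrow> ('m \<Rightarrow> 'n) \<Rightarrow> bool" where
  "linear_map K M N f \<longleftrightarrow>
     f \<in> carrier M \<rightarrow> carrier N \<and>
     (\<forall>x\<in>carrier M. \<forall>y\<in>carrier M. f (x \<oplus>\<^bsub>M\<^esub> y) = f x \<oplus>\<^bsub>N\<^esub> f y) \<and>
     (\<forall>c\<in>carrier K. \<forall>x\<in>carrier M. f (c \<odot>\<^bsub>M\<^esub> x) = c \<odot>\<^bsub>N\<^esub> f x)"

definition bilinear_map ::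
    "('k, 'r) ring_scheme \<Rightarrow> ('k, 'm, 's) module_scheme \<Rightarrow> ('k, 'n, 't) module_scheme
      \<Rightarrow> ('k, 'p, 'u) module_scheme \<Rightarrow> ('m \<Rightarrow> 'n \<Rightarrow> 'p) \<Rightarrow> bool" where
  "bilinear_map K M N P \<beta> \<longleftrightarrow>
     (\<forall>m\<in>carrier M. linear_map K N P (\<beta> m)) \<and>
     (\<forall>n\<in>carrier N. linear_map K M P (\<lambda>m. \<beta> m n))"


section \<open>Tensor products\<close>

text \<open>
  The tensor product of \<open>M\<close> and \<open>N\<close> is the free module on \<open>carrier M \<times> carrier N\<close> modulo the
  submodule generated by the bilinearity relations; its elements are cosets.  The ring
  multiplication fields of the HOL-Algebra module record play no role for modules and are left
  unspecified.
\<close>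

definition free_module :: "('k, 'r) ring_scheme \<Rightarrow> 'i set \<Rightarrow> ('k, 'i \<Rightarrow> 'k) module" where
  "free_module K S =
     \<lparr>carrier = {f. (\<forall>i\<in>S. f i \<in> carrier K) \<and> (\<forall>i. i \<notin> S \<longrightarrow> f i = \<zero>\<^bsub>K\<^esub>) \<and>
                    finite {i. f i \<noteq> \<zero>\<^bsub>K\<^esub>}},
      mult = undefined, one = undefined,
      zero = (\<lambda>i. \<zero>\<^bsub>K\<^esub>), add = (\<lambda>f g i. f i \<oplus>\<^bsub>K\<^esub> g i),
      smult = (\<lambda>c f i. c \<otimes>\<^bsub>K\<^esub> f i)\<rparr>"

definition free_basis :: "('k, 'r) ring_scheme \<Rightarrow> 'i \<Rightarrow> 'i \<Rightarrow> 'k" where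
  "free_basis K i = (\<lambda>j. if j = i then \<one>\<^bsub>K\<^esub> else \<zero>\<^bsub>K\<^esub>)"

definition generated_submodule ::
    "('k, 'r) ring_scheme \<Rightarrow> ('k, 'm, 's) module_scheme \<Rightarrow> 'm set \<Rightarrow> 'm set" where
  "generated_submodule K M A = \<Inter>{H. submodule H K M \<and> A \<subseteq> H}"

definition quotient_module ::
    "('k, 'm, 's) module_scheme \<Rightarrow> 'm set \<Rightarrow> ('k, 'm set) module" where
  "quotient_module M H =
     \<lparr>carrier = a_rcosets\<^bsub>M\<^esub> H,
      mult = undefined, one = undefined,
      zero = H, add = set_add M,
      smult = (\<lambda>c C. \<Union>x\<in>C. H +>\<^bsub>M\<^esub> (c \<odot>\<^bsub>M\<^esub> x))\<rparr>"

abbreviation free_pairs ::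
    "('k, 'r) ring_scheme \<Rightarrow> ('k, 'm, 's) module_scheme \<Rightarrow> ('k, 'n, 't) module_scheme
      \<Rightarrow> ('k, 'm \<times> 'n \<Rightarrow> 'k) module" where
  "free_pairs K M N \<equiv> free_module K (carrier M \<times> carrier N)"

definition tensor_relations ::
    "('k, 'r) ring_scheme \<Rightarrow> ('k, 'm, 's) module_scheme \<Rightarrow> ('k, 'n, 't) module_scheme
      \<Rightarrow> ('m \<times> 'n \<Rightarrow> 'k) set" where
  "tensor_relations K M N =
     (let F = free_pairs K M N; e = (\<lambda>m n. free_basis K (m, n)) in
       {e (m \<oplus>\<^bsub>M\<^esub> m') n \<ominus>\<^bsub>F\<^esub> (e m n \<oplus>\<^bsub>F\<^esub> e m' n) | m m' n.
          m \<in> carrier M \<and> m' \<in> carrier M \<and> n \<in> carrier N} \<union>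
       {e m (n \<oplus>\<^bsub>N\<^esub> n') \<ominus>\<^bsub>F\<^esub> (e m n \<oplus>\<^bsub>F\<^esub> e m n') | m n n'.
          m \<in> carrier M \<and> n \<in> carrier N \<and> n' \<in> carrier N} \<union>
       {e (c \<odot>\<^bsub>M\<^esub> m) n \<ominus>\<^bsub>F\<^esub> (c \<odot>\<^bsub>F\<^esub> e m n) | c m n.
          c \<in> carrier K \<and> m \<in> carrier M \<and> n \<in> carrier N} \<union>
       {e m (c \<odot>\<^bsub>N\<^esub> n) \<ominus>\<^bsub>F\<^esub> (c \<odot>\<^bsub>F\<^esub> e m n) | c m n.
          c \<in> carrier K \<and> m \<in> carrier M \<and> n \<in> carrier N})"

definition tensor_null ::
    "('k, 'r) ring_scheme \<Rightarrow> ('k, 'm, 's) module_scheme \<Rightarrow> ('k, 'n, 't) module_scheme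
      \<Rightarrow> ('m \<times> 'n \<Rightarrow> 'k) set" where
  "tensor_null K M N = generated_submodule K (free_pairs K M N) (tensor_relations K M N)"

definition tensor_product ::
    "('k, 'r) ring_scheme \<Rightarrow> ('k, 'm, 's) module_scheme \<Rightarrow> ('k, 'n, 't) module_scheme
      \<Rightarrow> ('k, ('m \<times> 'n \<Rightarrow> 'k) set) module" where
  "tensor_product K M N = quotient_module (free_pairs K M N) (tensor_null K M N)"

definition tensor ::
    "('k, 'r) ring_scheme \<Rightarrow> ('k, 'm, 's) module_scheme \<Rightarrow> ('k, 'n, 't) module_scheme
      \<Rightarrow> 'm \<Rightarrow> 'n \<Rightarrow> ('m \<times> 'n \<Rightarrow> 'k) set" where
  "tensor K M N m n = tensor_null K M N +>\<^bsub>free_pairs K M N\<^esub> free_basis K (m, n)"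

text \<open>
  For bilinear \<open>\<beta>\<close>, \<open>tensor_lift K M N P \<beta>\<close> is the linear map on the tensor product with
  \<open>m \<otimes> n \<mapsto> \<beta> m n\<close>: all representatives of a coset have the same image under the linear
  extension of \<open>\<beta>\<close> to the free module.
\<close>

definition tensor_lift ::
    "('k, 'r) ring_scheme \<Rightarrow> ('k, 'm, 's) module_scheme \<Rightarrow> ('k, 'n, 't) module_scheme
      \<Rightarrow> ('k, 'p, 'u) module_scheme \<Rightarrow> ('m \<Rightarrow> 'n \<Rightarrow> 'p) \<Rightarrow> ('m \<times> 'n \<Rightarrow> 'k) set \<Rightarrow> 'p" where
  "tensor_lift K M N P \<beta> C =
     the_elem ((\<lambda>f. \<Oplus>\<^bsub>P\<^esub>i\<in>{i. f i \<noteq> \<zero>\<^bsub>K\<^esub>}. f i \<odot>\<^bsub>P\<^esub> \<beta> (fst i) (snd i)) ` C)"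

definition tensor_map ::
    "('k, 'r) ring_scheme \<Rightarrow> ('k, 'm, 's) module_scheme \<Rightarrow> ('k, 'n, 't) module_scheme
      \<Rightarrow> ('k, 'p, 'u) module_scheme \<Rightarrow> ('k, 'q, 'v) module_scheme
      \<Rightarrow> ('m \<Rightarrow> 'p) \<Rightarrow> ('n \<Rightarrow> 'q) \<Rightarrow> ('m \<times> 'n \<Rightarrow> 'k) set \<Rightarrow> ('p \<times> 'q \<Rightarrow> 'k) set" where
  "tensor_map K M N P Q f g =
     tensor_lift K M N (tensor_product K P Q) (\<lambda>m n. tensor K P Q (f m) (g n))"

text \<open>
  Triple tensor products are bracketed to the right.  If \<open>t = \<Sum> t\<^sup>1 \<otimes> (t\<^sup>2 \<otimes> t\<^sup>3)\<close> in Sweedler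
  notation and \<open>\<phi>\<close> is trilinear, then \<open>tensor_lift3 K M N P Q \<phi> t\<close> is \<open>\<Sum> \<phi> t\<^sup>1 t\<^sup>2 t\<^sup>3\<close>.
\<close>

definition tensor_lift3 ::
    "('k, 'r) ring_scheme \<Rightarrow> ('k, 'm, 's) module_scheme \<Rightarrow> ('k, 'n, 't) module_scheme
      \<Rightarrow> ('k, 'p, 'u) module_scheme \<Rightarrow> ('k, 'q, 'v) module_scheme
      \<Rightarrow> ('m \<Rightarrow> 'n \<Rightarrow> 'p \<Rightarrow> 'q) \<Rightarrow> ('m \<times> ('n \<times> 'p \<Rightarrow> 'k) set \<Rightarrow> 'k) set \<Rightarrow> 'q" where
  "tensor_lift3 K M N P Q \<phi> =
     tensor_lift K M (tensor_product K N P) Q (\<lambda>m. tensor_lift K N P Q (\<phi> m))"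

definition tensor_assoc ::
    "('k, 'r) ring_scheme \<Rightarrow> ('k, 'm, 's) module_scheme \<Rightarrow> ('k, 'n, 't) module_scheme
      \<Rightarrow> ('k, 'p, 'u) module_scheme
      \<Rightarrow> (('m \<times> 'n \<Rightarrow> 'k) set \<times> 'p \<Rightarrow> 'k) set \<Rightarrow> ('m \<times> ('n \<times> 'p \<Rightarrow> 'k) set \<Rightarrow> 'k) set" where
  "tensor_assoc K M N P =
     (let A = tensor_product K M (tensor_product K N P) in
       tensor_lift K (tensor_product K M N) P A
         (\<lambda>s p. tensor_lift K M N A
           (\<lambda>m n. tensor K M (tensor_product K N P) m (tensor K N P n p)) s))"

definition tensor_assoc_inv ::
    "('k, 'r) ring_scheme \<Rightarrow> ('k, 'm, 's) module_scheme \<Rightarrow> ('k, 'n, 't) module_scheme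
      \<Rightarrow> ('k, 'p, 'u) module_scheme
      \<Rightarrow> ('m \<times> ('n \<times> 'p \<Rightarrow> 'k) set \<Rightarrow> 'k) set \<Rightarrow> (('m \<times> 'n \<Rightarrow> 'k) set \<times> 'p \<Rightarrow> 'k) set" where
  "tensor_assoc_inv K M N P =
     tensor_lift3 K M N P (tensor_product K (tensor_product K M N) P)
       (\<lambda>m n p. tensor K (tensor_product K M N) P (tensor K M N m n) p)"


section \<open>Pre-Yang-Baxter operators\<close>

text \<open>
  The braid equation is stated on \<open>(V \<otimes> V) \<otimes> V\<close>; \<open>1 \<otimes> R\<close> is transported there along the
  associator.
\<close>

definition pre_yang_baxter_operator ::
    "('k, 'r) ring_scheme \<Rightarrow> ('k, 'v, 's) module_scheme
      \<Rightarrow> (('v \<times> 'v \<Rightarrow> 'k) set \<Rightarrow> ('v \<times> 'v \<Rightarrow> 'k) set) \<Rightarrow> bool" where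
  "pre_yang_baxter_operator K V R \<longleftrightarrow>
     (let VV = tensor_product K V V;
          R1 = tensor_map K VV V VV V R id;
          R2 = tensor_assoc_inv K V V V \<circ> tensor_map K V VV V VV id R \<circ> tensor_assoc K V V V
      in linear_map K VV VV R \<and>
         (\<forall>t\<in>carrier (tensor_product K VV V). (R1 \<circ> R2 \<circ> R1) t = (R2 \<circ> R1 \<circ> R2) t))"


section \<open>Lie algebras and the associated ternary structure\<close>

locale lie_algebra = K?: field K + L?: module K L
  for K :: "('k, 'r) ring_scheme" (structure)
    and L :: "('k, 'l, 's) module_scheme" (structure) +
  fixes br :: "'l \<Rightarrow> 'l \<Rightarrow> 'l"
  assumes br_bilinear: "bilinear_map K L L L br"
    and br_alternating: "x \<in> carrier L \<Longrightarrow> br x x = \<zero>\<^bsub>L\<^esub>"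
    and br_jacobi:
      "\<lbrakk>x \<in> carrier L; y \<in> carrier L; z \<in> carrier L\<rbrakk> \<Longrightarrow>
        br x (br y z) \<oplus>\<^bsub>L\<^esub> br y (br z x) \<oplus>\<^bsub>L\<^esub> br z (br x y) = \<zero>\<^bsub>L\<^esub>"

definition lie_X ::
    "('k, 'r) ring_scheme \<Rightarrow> ('k, 'l, 's) module_scheme \<Rightarrow> ('k, 'k \<times> 'l) module" where
  "lie_X K L =
     \<lparr>carrier = carrier K \<times> carrier L,
      mult = undefined, one = undefined,
      zero = (\<zero>\<^bsub>K\<^esub>, \<zero>\<^bsub>L\<^esub>),
      add = (\<lambda>(a, x) (b, y). (a \<oplus>\<^bsub>K\<^esub> b, x \<oplus>\<^bsub>L\<^esub> y)),
      smult = (\<lambda>c (a, x). (c \<otimes>\<^bsub>K\<^esub> a, c \<odot>\<^bsub>L\<^esub> x))\<rparr>"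

definition lie_Delta ::
    "('k, 'r) ring_scheme \<Rightarrow> ('k, 'l, 's) module_scheme
      \<Rightarrow> 'k \<times> 'l \<Rightarrow> (('k \<times> 'l) \<times> ('k \<times> 'l) \<Rightarrow> 'k) set" where
  "lie_Delta K L = (\<lambda>(a, x).
     let X = lie_X K L in
       tensor K X X (a, x) (\<one>\<^bsub>K\<^esub>, \<zero>\<^bsub>L\<^esub>)
         \<oplus>\<^bsub>tensor_product K X X\<^esub> tensor K X X (\<one>\<^bsub>K\<^esub>, \<zero>\<^bsub>L\<^esub>) (\<zero>\<^bsub>K\<^esub>, x))"

definition lie_Delta3 ::
    "('k, 'r) ring_scheme \<Rightarrow> ('k, 'l, 's) module_scheme
      \<Rightarrow> 'k \<times> 'l \<Rightarrow> (('k \<times> 'l) \<times> (('k \<times> 'l) \<times> ('k \<times> 'l) \<Rightarrow> 'k) set \<Rightarrow> 'k) set" where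
  "lie_Delta3 K L =
     (let X = lie_X K L in tensor_map K X X X (tensor_product K X X) id (lie_Delta K L))
       \<circ> lie_Delta K L"

definition lie_T ::
    "('k, 'r) ring_scheme \<Rightarrow> ('k, 'l, 's) module_scheme \<Rightarrow> ('l \<Rightarrow> 'l \<Rightarrow> 'l)
      \<Rightarrow> (('k \<times> 'l) \<times> (('k \<times> 'l) \<times> ('k \<times> 'l) \<Rightarrow> 'k) set \<Rightarrow> 'k) set \<Rightarrow> 'k \<times> 'l" where
  "lie_T K L br =
     (let X = lie_X K L in
       tensor_lift3 K X X X X (\<lambda>(a, x) (b, y) (c, z).
         (a \<otimes>\<^bsub>K\<^esub> b \<otimes>\<^bsub>K\<^esub> c,
          (b \<otimes>\<^bsub>K\<^esub> c) \<odot>\<^bsub>L\<^esub> x \<oplus>\<^bsub>L\<^esub> c \<odot>\<^bsub>L\<^esub> br x y \<oplus>\<^bsub>L\<^esub> b \<odot>\<^bsub>L\<^esub> br x z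
            \<oplus>\<^bsub>L\<^esub> br (br x y) z)))"

definition lie_XX ::
    "('k, 'r) ring_scheme \<Rightarrow> ('k, 'l, 's) module_scheme
      \<Rightarrow> ('k, (('k \<times> 'l) \<times> ('k \<times> 'l) \<Rightarrow> 'k) set) module" where
  "lie_XX K L = tensor_product K (lie_X K L) (lie_X K L)"

text \<open>
  The two nested lifts are the Sweedler sums over \<open>\<Delta>\<^sub>3 z\<close> and \<open>\<Delta>\<^sub>3 w\<close> in
  \<open>R (x \<otimes> y \<otimes> z \<otimes> w) = z\<^sup>1 \<otimes> w\<^sup>1 \<otimes> T (x \<otimes> z\<^sup>2 \<otimes> w\<^sup>2) \<otimes> T (y \<otimes> z\<^sup>3 \<otimes> w\<^sup>3)\<close>.
\<close>

definition is_lie_R ::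
    "('k, 'r) ring_scheme \<Rightarrow> ('k, 'l, 's) module_scheme \<Rightarrow> ('l \<Rightarrow> 'l \<Rightarrow> 'l)
      \<Rightarrow> (((('k \<times> 'l) \<times> ('k \<times> 'l) \<Rightarrow> 'k) set \<times> (('k \<times> 'l) \<times> ('k \<times> 'l) \<Rightarrow> 'k) set \<Rightarrow> 'k) set
           \<Rightarrow> ((('k \<times> 'l) \<times> ('k \<times> 'l) \<Rightarrow> 'k) set \<times> (('k \<times> 'l) \<times> ('k \<times> 'l) \<Rightarrow> 'k) set \<Rightarrow> 'k) set)
      \<Rightarrow> bool" where
  "is_lie_R K L br R \<longleftrightarrow>
     (let X = lie_X K L; V = lie_XX K L; VV = tensor_product K V V;
          T = lie_T K L br; \<Delta>\<^sub>3 = lie_Delta3 K L;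
          t2 = tensor K X X; t3 = (\<lambda>x y z. tensor K X V x (t2 y z)); t22 = tensor K V V
      in linear_map K VV VV R \<and>
         (\<forall>x\<in>carrier X. \<forall>y\<in>carrier X. \<forall>z\<in>carrier X. \<forall>w\<in>carrier X.
           R (t22 (t2 x y) (t2 z w)) =
             tensor_lift3 K X X X VV (\<lambda>z1 z2 z3.
               tensor_lift3 K X X X VV (\<lambda>w1 w2 w3.
                 t22 (t2 z1 w1) (t2 (T (t3 x z2 w2)) (T (t3 y z3 w3))))
               (\<Delta>\<^sub>3 w))
             (\<Delta>\<^sub>3 z)))"

end

theory Submission
  imports Defs
begin

text \<open>
  Put \<open>q (a, x) (b, y) = (a b, b x + [x, y])\<close>.  Then \<open>T (x \<otimes> y \<otimes> z) = q (q x y) z\<close>, the element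
  \<open>(1, 0)\<close> acts as the identity under \<open>q\<close>, and each \<open>(0, s)\<close> acts through \<open>L\<close>, diagonally on
  \<open>V = X \<otimes> X\<close>; write \<open>D s\<close> for this action.  Since
  \<open>\<Delta> (a, p) = (a, p) \<otimes> (1, 0) + (1, 0) \<otimes> (0, p)\<close>, the operator has the closed form
  \<open>R (v \<otimes> (z \<otimes> w)) = (z \<otimes> w) \<otimes> v + (z \<otimes> 1) \<otimes> D r v + (1 \<otimes> w) \<otimes> D p v + (1 \<otimes> 1) \<otimes> D r (D p v)\<close>
  for \<open>z = (a, p)\<close> and \<open>w = (b, r)\<close>.  Moving an element of \<open>V\<close> across \<open>V \<otimes> V\<close> by two copies of \<open>R\<close>
  gives the same formula with the diagonal action on \<open>V \<otimes> V\<close>.  As the Jacobi identity makes \<open>R\<close>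
  commute with that action, applying \<open>R\<close> to the other two factors before or after the crossing
  gives the same result, which is the braid equation.
\<close>

section \<open>Linear maps\<close>

lemma linear_mapI:
  assumes "\<And>x. x \<in> carrier M \<Longrightarrow> f x \<in> carrier N"
    and "\<And>x y. \<lbrakk>x \<in> carrier M; y \<in> carrier M\<rbrakk> \<Longrightarrow> f (x \<oplus>\<^bsub>M\<^esub> y) = f x \<oplus>\<^bsub>N\<^esub> f y"
    and "\<And>c x. \<lbrakk>c \<in> carrier K; x \<in> carrier M\<rbrakk> \<Longrightarrow> f (c \<odot>\<^bsub>M\<^esub> x) = c \<odot>\<^bsub>N\<^esub> f x"
  shows "linear_map K M N f"
  using assms by (auto simp: linear_map_def)

lemma linear_map_closed: "\<lbrakk>linear_map K M N f; x \<in> carrier M\<rbrakk> \<Longrightarrow> f x \<in> carrier N"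
  by (auto simp: linear_map_def)

lemma linear_map_add:
  "\<lbrakk>linear_map K M N f; x \<in> carrier M; y \<in> carrier M\<rbrakk> \<Longrightarrow> f (x \<oplus>\<^bsub>M\<^esub> y) = f x \<oplus>\<^bsub>N\<^esub> f y"
  by (auto simp: linear_map_def)

lemma linear_map_smult:
  "\<lbrakk>linear_map K M N f; c \<in> carrier K; x \<in> carrier M\<rbrakk> \<Longrightarrow> f (c \<odot>\<^bsub>M\<^esub> x) = c \<odot>\<^bsub>N\<^esub> f x"
  by (auto simp: linear_map_def)

lemma linear_map_zero:
  assumes "module K M" "module K N" "linear_map K M N f"
  shows "f \<zero>\<^bsub>M\<^esub> = \<zero>\<^bsub>N\<^esub>"
proof -
  interpret M: module K M by fact
  interpret N: module K N by fact
  have "f \<zero>\<^bsub>M\<^esub> = f (\<zero>\<^bsub>K\<^esub> \<odot>\<^bsub>M\<^esub> \<zero>\<^bsub>M\<^esub>)" by simp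
  also have "\<dots> = \<zero>\<^bsub>K\<^esub> \<odot>\<^bsub>N\<^esub> f \<zero>\<^bsub>M\<^esub>"
    by (rule linear_map_smult[OF assms(3)]) auto
  also have "\<dots> = \<zero>\<^bsub>N\<^esub>" using linear_map_closed[OF assms(3)] by simp
  finally show ?thesis .
qed

lemma linear_map_ident: "linear_map K M M (\<lambda>x. x)"
  by (simp add: linear_map_def)

lemma linear_map_compose:
  "\<lbrakk>linear_map K N P g; linear_map K M N f\<rbrakk> \<Longrightarrow> linear_map K M P (\<lambda>x. g (f x))"
  by (auto simp: linear_map_def Pi_def)

lemma linear_map_plus:
  assumes "module K N" "linear_map K M N f" "linear_map K M N g"
  shows "linear_map K M N (\<lambda>x. f x \<oplus>\<^bsub>N\<^esub> g x)"
proof -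
  interpret N: module K N by fact
  note closed = linear_map_closed[OF assms(2)] linear_map_closed[OF assms(3)]
  show ?thesis
    by (rule linear_mapI)
      (simp_all add: closed linear_map_add[OF assms(2)] linear_map_add[OF assms(3)]
        linear_map_smult[OF assms(2)] linear_map_smult[OF assms(3)] N.a_ac N.smult_r_distr)
qed

lemma linear_map_scale:
  assumes "module K N" "linear_map K M N f" "c \<in> carrier K"
  shows "linear_map K M N (\<lambda>x. c \<odot>\<^bsub>N\<^esub> f x)"
proof -
  interpret N: module K N by fact
  note closed = linear_map_closed[OF assms(2)]
  show ?thesis
    by (rule linear_mapI)
      (simp_all add: assms(3) closed linear_map_add[OF assms(2)]
        linear_map_smult[OF assms(2)] N.smult_r_distr N.R.m_comm flip: N.smult_assoc1)
qed

text \<open>Formulas such as \<open>lie_T_kernel_eq\<close> hold on carriers only, so linearity has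
  to be transferred along agreement there and not along equality of functions.\<close>

lemma linear_map_cong:
  assumes "module K M" "\<And>x. x \<in> carrier M \<Longrightarrow> f x = g x"
  shows "linear_map K M N f \<longleftrightarrow> linear_map K M N g"
proof -
  interpret M: module K M by fact
  show ?thesis by (auto simp: linear_map_def assms(2) Pi_def)
qed

lemma bilinear_mapI:
  assumes "\<And>m. m \<in> carrier M \<Longrightarrow> linear_map K N P (\<lambda>n. \<beta> m n)"
    and "\<And>n. n \<in> carrier N \<Longrightarrow> linear_map K M P (\<lambda>m. \<beta> m n)"
  shows "bilinear_map K M N P \<beta>"
  using assms by (auto simp: bilinear_map_def)

lemma bilinear_map_left:
  "\<lbrakk>bilinear_map K M N P \<beta>; linear_map K A M f; n \<in> carrier N\<rbrakk>
    \<Longrightarrow> linear_map K A P (\<lambda>x. \<beta> (f x) n)"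
  unfolding bilinear_map_def using linear_map_compose[of K M P "\<lambda>m. \<beta> m n" A f] by blast

lemma bilinear_map_right:
  "\<lbrakk>bilinear_map K M N P \<beta>; m \<in> carrier M; linear_map K A N f\<rbrakk>
    \<Longrightarrow> linear_map K A P (\<lambda>x. \<beta> m (f x))"
  unfolding bilinear_map_def using linear_map_compose[of K N P "\<beta> m" A f] by blast

lemma bilinear_map_closed:
  "\<lbrakk>bilinear_map K M N P \<beta>; m \<in> carrier M; n \<in> carrier N\<rbrakk> \<Longrightarrow> \<beta> m n \<in> carrier P"
  unfolding bilinear_map_def by (blast intro: linear_map_closed)

section \<open>Free modules\<close>

lemma module_free_module:
  fixes K :: "('k, 'r) ring_scheme" and S :: "'i set"
  assumes "cring K" shows "module K (free_module K S)"
proof -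
  interpret cring K by fact
  have supp_add: "finite {i. f i \<oplus>\<^bsub>K\<^esub> g i \<noteq> \<zero>\<^bsub>K\<^esub>}"
    if "finite {i. f i \<noteq> \<zero>\<^bsub>K\<^esub>}" "finite {i. g i \<noteq> \<zero>\<^bsub>K\<^esub>}" for f g :: "'i \<Rightarrow> 'k"
    by (rule finite_subset[OF _ finite_UnI[OF that]]) auto
  have supp_smult: "finite {i. c \<otimes>\<^bsub>K\<^esub> f i \<noteq> \<zero>\<^bsub>K\<^esub>}"
    if "finite {i. f i \<noteq> \<zero>\<^bsub>K\<^esub>}" "c \<in> carrier K" for c and f :: "'i \<Rightarrow> 'k"
    by (rule finite_subset[OF _ that(1)]) (use that in auto)
  have mem: "f i \<in> carrier K" if "f \<in> carrier (free_module K S)" for f i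
    using that by (cases "i \<in> S") (auto simp: free_module_def)
  have ab: "abelian_group (free_module K S)"
  proof (rule abelian_groupI)
    fix f assume f: "f \<in> carrier (free_module K S)"
    have "(\<lambda>i. \<ominus>\<^bsub>K\<^esub> f i) \<in> carrier (free_module K S)"
    proof -
      have "finite {i. \<ominus>\<^bsub>K\<^esub> f i \<noteq> \<zero>\<^bsub>K\<^esub>}"
        by (rule finite_subset[of _ "{i. f i \<noteq> \<zero>\<^bsub>K\<^esub>}"]) (use f in \<open>auto simp: free_module_def\<close>)
      with f show ?thesis by (auto simp: free_module_def)
    qed
    moreover have "(\<lambda>i. \<ominus>\<^bsub>K\<^esub> f i) \<oplus>\<^bsub>free_module K S\<^esub> f = \<zero>\<^bsub>free_module K S\<^esub>"
      using mem[OF f] by (auto simp: free_module_def l_neg)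
    ultimately show "\<exists>g\<in>carrier (free_module K S). g \<oplus>\<^bsub>free_module K S\<^esub> f = \<zero>\<^bsub>free_module K S\<^esub>"
      by blast
  next
    fix f g assume fg: "f \<in> carrier (free_module K S)" "g \<in> carrier (free_module K S)"
    then show "f \<oplus>\<^bsub>free_module K S\<^esub> g \<in> carrier (free_module K S)"
      using supp_add[of f g] by (auto simp: free_module_def)
    show "f \<oplus>\<^bsub>free_module K S\<^esub> g = g \<oplus>\<^bsub>free_module K S\<^esub> f"
      using mem[OF fg(1)] mem[OF fg(2)] by (auto simp: free_module_def a_comm)
    fix h assume "h \<in> carrier (free_module K S)"
    from mem[OF fg(1)] mem[OF fg(2)] mem[OF this]
    show "f \<oplus>\<^bsub>free_module K S\<^esub> g \<oplus>\<^bsub>free_module K S\<^esub> h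
        = f \<oplus>\<^bsub>free_module K S\<^esub> (g \<oplus>\<^bsub>free_module K S\<^esub> h)"
      by (auto simp: free_module_def a_assoc)
  next
    fix f assume "f \<in> carrier (free_module K S)"
    from mem[OF this] show "\<zero>\<^bsub>free_module K S\<^esub> \<oplus>\<^bsub>free_module K S\<^esub> f = f"
      by (auto simp: free_module_def)
  qed (auto simp: free_module_def)
  show ?thesis
  proof (rule moduleI[OF assms ab])
    fix c f assume "c \<in> carrier K" "f \<in> carrier (free_module K S)"
    then show "c \<odot>\<^bsub>free_module K S\<^esub> f \<in> carrier (free_module K S)"
      using supp_smult[of f c] by (auto simp: free_module_def)
  next
    fix f assume "f \<in> carrier (free_module K S)"
    from mem[OF this] show "\<one>\<^bsub>K\<^esub> \<odot>\<^bsub>free_module K S\<^esub> f = f"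
      by (auto simp: free_module_def)
  next
    fix a b f assume "a \<in> carrier K" "b \<in> carrier K" "f \<in> carrier (free_module K S)"
    with mem[OF this(3)]
    show "(a \<oplus>\<^bsub>K\<^esub> b) \<odot>\<^bsub>free_module K S\<^esub> f
        = a \<odot>\<^bsub>free_module K S\<^esub> f \<oplus>\<^bsub>free_module K S\<^esub> b \<odot>\<^bsub>free_module K S\<^esub> f"
      and "(a \<otimes>\<^bsub>K\<^esub> b) \<odot>\<^bsub>free_module K S\<^esub> f = a \<odot>\<^bsub>free_module K S\<^esub> (b \<odot>\<^bsub>free_module K S\<^esub> f)"
      by (auto simp: free_module_def l_distr m_assoc)
  next
    fix a f g
    assume "a \<in> carrier K" "f \<in> carrier (free_module K S)" "g \<in> carrier (free_module K S)"
    with mem[OF this(2)] mem[OF this(3)]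
    show "a \<odot>\<^bsub>free_module K S\<^esub> (f \<oplus>\<^bsub>free_module K S\<^esub> g)
        = a \<odot>\<^bsub>free_module K S\<^esub> f \<oplus>\<^bsub>free_module K S\<^esub> a \<odot>\<^bsub>free_module K S\<^esub> g"
      by (auto simp: free_module_def r_distr)
  qed
qed

lemma free_basis_closed:
  assumes "cring K" "i \<in> S" shows "free_basis K i \<in> carrier (free_module K S)"
proof -
  interpret cring K by fact
  have "finite {j. free_basis K i j \<noteq> \<zero>\<^bsub>K\<^esub>}"
    by (rule finite_subset[of _ "{i}"]) (auto simp: free_basis_def)
  with assms show ?thesis by (auto simp: free_module_def free_basis_def)
qed

text \<open>Induction on the finite support, removing one index at a time.\<close>

lemma free_module_induct [consumes 2, case_names zero add basis]:
  assumes K: "cring K" and f: "f \<in> carrier (free_module K S)"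
    and zero: "Q \<zero>\<^bsub>free_module K S\<^esub>"
    and add: "\<And>f g. \<lbrakk>f \<in> carrier (free_module K S); g \<in> carrier (free_module K S); Q f; Q g\<rbrakk>
      \<Longrightarrow> Q (f \<oplus>\<^bsub>free_module K S\<^esub> g)"
    and basis: "\<And>c i. \<lbrakk>c \<in> carrier K; i \<in> S\<rbrakk> \<Longrightarrow> Q (c \<odot>\<^bsub>free_module K S\<^esub> free_basis K i)"
  shows "Q f"
proof -
  interpret cring K by fact
  interpret F: module K "free_module K S" by (rule module_free_module[OF K])
  have "finite A \<Longrightarrow> {i. f i \<noteq> \<zero>\<^bsub>K\<^esub>} = A \<Longrightarrow> f \<in> carrier (free_module K S) \<Longrightarrow> Q f" for A f
  proof (induction A arbitrary: f rule: finite_induct)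
    case empty
    then have "f = \<zero>\<^bsub>free_module K S\<^esub>" by (auto simp: free_module_def)
    with zero show ?case by simp
  next
    case (insert i A)
    \<comment> \<open>\<open>?g\<close> erases the value at \<open>i\<close>, which shrinks the
      support to \<open>A\<close>; \<open>?h\<close> restores it as a multiple of a basis
      vector.\<close>
    let ?g = "f(i := \<zero>\<^bsub>K\<^esub>)" and ?h = "f i \<odot>\<^bsub>free_module K S\<^esub> free_basis K i"
    from insert have i: "i \<in> S" "f i \<in> carrier K" "f i \<noteq> \<zero>\<^bsub>K\<^esub>"
      by (auto simp: free_module_def)
    have supp: "{j. ?g j \<noteq> \<zero>\<^bsub>K\<^esub>} = A" using insert by (auto split: if_splits)
    have g: "?g \<in> carrier (free_module K S)"
      using insert.prems(2) insert.hyps(1) supp by (auto simp: free_module_def)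
    have h: "?h \<in> carrier (free_module K S)"
      using i free_basis_closed[OF K i(1)] by (intro F.smult_closed)
    have mem: "f j \<in> carrier K" for j
      using insert.prems(2) by (cases "j \<in> S") (auto simp: free_module_def)
    have "?g \<oplus>\<^bsub>free_module K S\<^esub> ?h = f"
      using mem by (auto simp: free_module_def free_basis_def)
    with add[OF g h insert.IH[OF supp g] basis[OF i(2,1)]] show ?case by metis
  qed
  from this[OF _ refl f] f show ?thesis by (simp add: free_module_def)
qed

text \<open>The linear extension of \<open>g\<close> to the free module. The sum runs over the
  support exactly as in \<open>tensor_lift\<close>, so \<open>tensor_lift\<close> unfolds to the
  image of a coset under \<open>free_lift\<close>.\<close>

definition free_lift ::
    "('k, 'r) ring_scheme \<Rightarrow> ('k, 'p, 'u) module_scheme \<Rightarrow> ('i \<Rightarrow> 'p) \<Rightarrow> ('i \<Rightarrow> 'k) \<Rightarrow> 'p" where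
  "free_lift K P g f = (\<Oplus>\<^bsub>P\<^esub>i\<in>{i. f i \<noteq> \<zero>\<^bsub>K\<^esub>}. f i \<odot>\<^bsub>P\<^esub> g i)"

text \<open>Indices off the support contribute zero. The freedom in \<open>A\<close> allows
  functions with different supports to be summed over one index set.\<close>

lemma free_lift_superset:
  assumes "module K P" "g \<in> S \<rightarrow> carrier P" "f \<in> carrier (free_module K S)"
    and "finite A" "{i. f i \<noteq> \<zero>\<^bsub>K\<^esub>} \<subseteq> A" "A \<subseteq> S"
  shows "free_lift K P g f = (\<Oplus>\<^bsub>P\<^esub>i\<in>A. f i \<odot>\<^bsub>P\<^esub> g i)"
proof -
  interpret P: module K P by fact
  show ?thesis unfolding free_lift_def
    by (rule P.add.finprod_mono_neutral_cong_left)
      (use assms in \<open>auto simp: free_module_def Pi_def subset_iff\<close>)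
qed

lemma free_lift_linear:
  assumes "module K P" "g \<in> S \<rightarrow> carrier P"
  shows "linear_map K (free_module K S) P (free_lift K P g)"
proof -
  interpret P: module K P by fact
  interpret F: module K "free_module K S" by (rule module_free_module) unfold_locales
  have supp: "finite {i. f i \<noteq> \<zero>\<^bsub>K\<^esub>}" "{i. f i \<noteq> \<zero>\<^bsub>K\<^esub>} \<subseteq> S" "\<And>i. i \<in> S \<Longrightarrow> f i \<in> carrier K"
    if "f \<in> carrier (free_module K S)" for f
    using that by (auto simp: free_module_def)
  note sup = free_lift_superset[OF assms]
  have gS: "g i \<in> carrier P" if "i \<in> S" for i using assms that by auto
  show ?thesis
  proof (rule linear_mapI)
    fix f assume f: "f \<in> carrier (free_module K S)"
    show "free_lift K P g f \<in> carrier P"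
      unfolding free_lift_def
      by (rule P.finsum_closed) (use supp[OF f] gS in auto)
  next
    fix f h assume f: "f \<in> carrier (free_module K S)" and h: "h \<in> carrier (free_module K S)"
    \<comment> \<open>Cancellation can make the support of the sum smaller than this union, so all
      three sums are taken over the union.\<close>
    let ?A = "{i. f i \<noteq> \<zero>\<^bsub>K\<^esub>} \<union> {i. h i \<noteq> \<zero>\<^bsub>K\<^esub>}"
    have A: "finite ?A" "?A \<subseteq> S" using supp[OF f] supp[OF h] by auto
    have "free_lift K P g (f \<oplus>\<^bsub>free_module K S\<^esub> h)
        = (\<Oplus>\<^bsub>P\<^esub>i\<in>?A. (f \<oplus>\<^bsub>free_module K S\<^esub> h) i \<odot>\<^bsub>P\<^esub> g i)"
      by (rule sup) (use A f h F.a_closed[OF f h] in \<open>auto simp: free_module_def\<close>)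
    also have "\<dots> = (\<Oplus>\<^bsub>P\<^esub>i\<in>?A. f i \<odot>\<^bsub>P\<^esub> g i \<oplus>\<^bsub>P\<^esub> h i \<odot>\<^bsub>P\<^esub> g i)"
      by (rule P.add.finprod_cong')
        (use A gS supp[OF f] supp[OF h] in
          \<open>auto simp: free_module_def P.smult_l_distr subset_iff\<close>)
    also have "\<dots> = (\<Oplus>\<^bsub>P\<^esub>i\<in>?A. f i \<odot>\<^bsub>P\<^esub> g i) \<oplus>\<^bsub>P\<^esub> (\<Oplus>\<^bsub>P\<^esub>i\<in>?A. h i \<odot>\<^bsub>P\<^esub> g i)"
      by (rule P.finsum_addf) (use A gS supp[OF f] supp[OF h] in \<open>auto simp: subset_iff\<close>)
    also have "\<dots> = free_lift K P g f \<oplus>\<^bsub>P\<^esub> free_lift K P g h"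
      using sup[OF f A(1) _ A(2)] sup[OF h A(1) _ A(2)] by auto
    finally show "free_lift K P g (f \<oplus>\<^bsub>free_module K S\<^esub> h)
        = free_lift K P g f \<oplus>\<^bsub>P\<^esub> free_lift K P g h" .
  next
    fix c f assume c: "c \<in> carrier K" and f: "f \<in> carrier (free_module K S)"
    let ?A = "{i. f i \<noteq> \<zero>\<^bsub>K\<^esub>}"
    have "free_lift K P g (c \<odot>\<^bsub>free_module K S\<^esub> f)
        = (\<Oplus>\<^bsub>P\<^esub>i\<in>?A. (c \<odot>\<^bsub>free_module K S\<^esub> f) i \<odot>\<^bsub>P\<^esub> g i)"
      by (rule sup) (use c f F.smult_closed[OF c f] supp[OF f] in \<open>auto simp: free_module_def\<close>)
    also have "\<dots> = (\<Oplus>\<^bsub>P\<^esub>i\<in>?A. c \<odot>\<^bsub>P\<^esub> (f i \<odot>\<^bsub>P\<^esub> g i))"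
      by (rule P.add.finprod_cong')
        (use c gS supp[OF f] in \<open>auto simp: free_module_def P.smult_assoc1 subset_iff\<close>)
    also have "\<dots> = c \<odot>\<^bsub>P\<^esub> free_lift K P g f"
      unfolding free_lift_def
      by (rule P.finsum_smult_ldistr[symmetric])
        (use c gS supp[OF f] in \<open>auto simp: subset_iff\<close>)
    finally show "free_lift K P g (c \<odot>\<^bsub>free_module K S\<^esub> f) = c \<odot>\<^bsub>P\<^esub> free_lift K P g f" .
  qed
qed

lemma free_lift_basis:
  assumes "module K P" "g \<in> S \<rightarrow> carrier P" "i \<in> S"
  shows "free_lift K P g (free_basis K i) = g i"
proof -
  interpret P: module K P by fact
  have "free_lift K P g (free_basis K i) = (\<Oplus>\<^bsub>P\<^esub>j\<in>{i}. free_basis K i j \<odot>\<^bsub>P\<^esub> g j)"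
    by (rule free_lift_superset[OF assms(1,2)])
      (use assms free_basis_closed[of K i S] P.R.cring_axioms in \<open>auto simp: free_basis_def\<close>)
  also have "\<dots> = g i" using assms by (auto simp: free_basis_def Pi_def)
  finally show ?thesis .
qed

section \<open>Quotient modules\<close>

lemma submodule_generated_submodule:
  assumes "module K M" "A \<subseteq> carrier M"
  shows "submodule (generated_submodule K M A) K M"
proof -
  interpret M: module K M by fact
  \<comment> \<open>The carrier belongs to the family being intersected, which keeps the
    intersection inside \<open>M\<close>.\<close>
  have carr: "submodule (carrier M) K M"
    by (rule M.submoduleI) auto
  have zero: "\<zero>\<^bsub>M\<^esub> \<in> H" if "submodule H K M" for H
    using subgroup.one_closed[OF submodule.axioms(1)[OF that]] by simp
  show ?thesis
  proof (rule M.submoduleI)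
    show "generated_submodule K M A \<subseteq> carrier M"
      using carr assms by (auto simp: generated_submodule_def)
  qed (auto simp: generated_submodule_def zero M.submoduleE(3,4,5))
qed

text \<open>Once the operations are known to be computed on representatives, the module axioms
  descend from \<open>M\<close> along the surjective projection.\<close>

lemma quotient_facts:
  assumes "module K M" "submodule H K M"
  shows "module K (quotient_module M H)"
    and "linear_map K M (quotient_module M H) (\<lambda>x. H +>\<^bsub>M\<^esub> x)"
    and "carrier (quotient_module M H) = (\<lambda>x. H +>\<^bsub>M\<^esub> x) ` carrier M"
proof -
  interpret M: module K M by fact
  have "abelian_subgroup H M"
    by (rule abelian_subgroupI3[OF additive_subgroupI[OF submodule.axioms(1)[OF assms(2)]]])
      unfold_locales
  then interpret H: abelian_subgroup H M .
  let ?Q = "quotient_module M H" and ?p = "\<lambda>x. H +>\<^bsub>M\<^esub> x"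
  have carr: "carrier ?Q = ?p ` carrier M"
    by (auto simp: quotient_module_def A_RCOSETS_def' a_r_coset_def')
  have add: "?p x \<oplus>\<^bsub>?Q\<^esub> ?p y = ?p (x \<oplus>\<^bsub>M\<^esub> y)" if "x \<in> carrier M" "y \<in> carrier M" for x y
    using H.a_rcos_sum[OF that] by (simp add: quotient_module_def)
  have zero: "\<zero>\<^bsub>?Q\<^esub> = ?p \<zero>\<^bsub>M\<^esub>"
    using H.a_subset by (simp add: quotient_module_def)
  have smult: "c \<odot>\<^bsub>?Q\<^esub> ?p x = ?p (c \<odot>\<^bsub>M\<^esub> x)" if cx: "c \<in> carrier K" "x \<in> carrier M" for c x
  proof -
    \<comment> \<open>The scalar multiple is defined as a union over representatives. Passing from
      \<open>x\<close> to \<open>h\<close> plus \<open>x\<close> changes the product by a multiple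
      of \<open>h\<close>, which stays in \<open>H\<close>, so all cosets in the union
      coincide.\<close>
    have eq: "?p (c \<odot>\<^bsub>M\<^esub> y) = ?p (c \<odot>\<^bsub>M\<^esub> x)" if "y \<in> ?p x" for y
    proof -
      from that obtain h where h: "h \<in> H" "y = h \<oplus>\<^bsub>M\<^esub> x" by (auto simp: a_r_coset_def')
      then have "c \<odot>\<^bsub>M\<^esub> y = c \<odot>\<^bsub>M\<^esub> h \<oplus>\<^bsub>M\<^esub> c \<odot>\<^bsub>M\<^esub> x"
        using cx H.a_subset by (auto simp: M.smult_r_distr)
      moreover have "c \<odot>\<^bsub>M\<^esub> h \<in> H"
        using M.submoduleE(4)[OF assms(2)] cx h by auto
      ultimately have "c \<odot>\<^bsub>M\<^esub> y \<in> ?p (c \<odot>\<^bsub>M\<^esub> x)" by (auto simp: a_r_coset_def')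
      then show ?thesis
        using H.a_repr_independence'[OF _ M.smult_closed[OF cx]] by simp
    qed
    moreover have "x \<in> ?p x" using H.a_rcos_self cx by simp
    ultimately have "(\<Union>y\<in>?p x. ?p (c \<odot>\<^bsub>M\<^esub> y)) = ?p (c \<odot>\<^bsub>M\<^esub> x)" by blast
    then show ?thesis by (simp add: quotient_module_def)
  qed
  show "carrier ?Q = ?p ` carrier M" by (rule carr)
  show "linear_map K M ?Q ?p"
    by (rule linear_mapI) (auto simp: carr add smult)
  have ab: "abelian_group ?Q"
  proof (rule abelian_groupI)
    fix C assume "C \<in> carrier ?Q"
    then obtain x where x: "x \<in> carrier M" "C = ?p x" by (auto simp: carr)
    then show "\<exists>D\<in>carrier ?Q. D \<oplus>\<^bsub>?Q\<^esub> C = \<zero>\<^bsub>?Q\<^esub>"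
      by (intro bexI[of _ "?p (\<ominus>\<^bsub>M\<^esub> x)"]) (auto simp: carr add zero M.l_neg)
  qed (auto simp: carr add zero M.a_ac)
  show "module K ?Q"
    by (rule moduleI[OF M.R.cring_axioms ab])
      (auto simp: carr add smult M.smult_l_distr M.smult_r_distr M.smult_assoc1)
qed

lemma quotient_eqI:
  assumes "module K M" "submodule H K M" "x \<in> carrier M" "y \<in> carrier M" "x \<ominus>\<^bsub>M\<^esub> y \<in> H"
  shows "H +>\<^bsub>M\<^esub> x = H +>\<^bsub>M\<^esub> y"
proof -
  interpret M: module K M by fact
  have "abelian_subgroup H M"
    by (rule abelian_subgroupI3[OF additive_subgroupI[OF submodule.axioms(1)[OF assms(2)]]])
      unfold_locales
  then interpret H: abelian_subgroup H M .
  show ?thesis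
    using H.a_rcos_module[OF assms(4,3)] H.a_repr_independence'[of x y] assms
    by (simp add: a_minus_def)
qed

lemmas module_quotient_module = quotient_facts(1)
  and quotient_projection_linear = quotient_facts(2)
  and carrier_quotient_module = quotient_facts(3)

lemma submodule_kernel:
  assumes "module K M" "module K N" "linear_map K M N f"
  shows "submodule {x \<in> carrier M. f x = \<zero>\<^bsub>N\<^esub>} K M"
proof -
  interpret M: module K M by fact
  interpret N: module K N by fact
  note f = linear_map_zero[OF assms] linear_map_add[OF assms(3)] linear_map_smult[OF assms(3)]
  have "f (\<ominus>\<^bsub>M\<^esub> x) = \<zero>\<^bsub>N\<^esub>" if "x \<in> carrier M" "f x = \<zero>\<^bsub>N\<^esub>" for x
  proof -
    have "f (\<ominus>\<^bsub>M\<^esub> x) = f (\<ominus>\<^bsub>M\<^esub> x) \<oplus>\<^bsub>N\<^esub> f x"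
      using that linear_map_closed[OF assms(3)] by simp
    also have "\<dots> = \<zero>\<^bsub>N\<^esub>"
      using that f(2)[of "\<ominus>\<^bsub>M\<^esub> x" x] by (simp add: M.l_neg f(1))
    finally show ?thesis .
  qed
  then show ?thesis
    by (intro M.submoduleI) (auto simp: f)
qed

lemma generated_submodule_least:
  "\<lbrakk>submodule H K M; A \<subseteq> H\<rbrakk> \<Longrightarrow> generated_submodule K M A \<subseteq> H"
  by (auto simp: generated_submodule_def)

lemma generated_submodule_superset: "A \<subseteq> generated_submodule K M A"
  by (auto simp: generated_submodule_def)

section \<open>Tensor products\<close>

context
  fixes K :: "('k, 'r) ring_scheme" and M :: "('k, 'm, 's) module_scheme"
    and N :: "('k, 'n, 't) module_scheme"
  assumes M: "module K M" and N: "module K N"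
begin

interpretation M: module K M by (rule M)
interpretation N: module K N by (rule N)
interpretation F: module K "free_pairs K M N"
  by (rule module_free_module) unfold_locales

lemma pair_basis_closed:
  "\<lbrakk>m \<in> carrier M; n \<in> carrier N\<rbrakk> \<Longrightarrow> free_basis K (m, n) \<in> carrier (free_pairs K M N)"
  by (rule free_basis_closed) (auto intro: M.R.cring_axioms)

lemma tensor_relations_subset: "tensor_relations K M N \<subseteq> carrier (free_pairs K M N)"
proof -
  have "f \<ominus>\<^bsub>free_pairs K M N\<^esub> g \<in> carrier (free_pairs K M N)"
    if "f \<in> carrier (free_pairs K M N)" "g \<in> carrier (free_pairs K M N)" for f g
    using that by (auto simp: F.minus_eq)
  note closed = this F.a_closed F.smult_closed pair_basis_closed
    M.a_closed N.a_closed M.smult_closed N.smult_closed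
  show ?thesis
    unfolding tensor_relations_def Let_def
    by (intro Un_least subsetI; elim CollectE exE conjE; hypsubst; intro closed; assumption)
qed

lemma submodule_tensor_null: "submodule (tensor_null K M N) K (free_pairs K M N)"
  unfolding tensor_null_def
  by (rule submodule_generated_submodule[OF F.module_axioms tensor_relations_subset])

lemma module_tensor_product: "module K (tensor_product K M N)"
  unfolding tensor_product_def
  by (rule module_quotient_module[OF F.module_axioms submodule_tensor_null])

private abbreviation (input) "proj \<equiv> (\<lambda>f. tensor_null K M N +>\<^bsub>free_pairs K M N\<^esub> f)"

lemma tensor_projection_linear:
  "linear_map K (free_pairs K M N) (tensor_product K M N) proj"
  unfolding tensor_product_def
  by (rule quotient_projection_linear[OF F.module_axioms submodule_tensor_null])

lemma carrier_tensor_product: "carrier (tensor_product K M N) = proj ` carrier (free_pairs K M N)"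
  unfolding tensor_product_def
  by (rule carrier_quotient_module[OF F.module_axioms submodule_tensor_null])

lemma tensor_projection_eqI:
  assumes "f \<ominus>\<^bsub>free_pairs K M N\<^esub> g \<in> tensor_relations K M N"
    and "f \<in> carrier (free_pairs K M N)" "g \<in> carrier (free_pairs K M N)"
  shows "proj f = proj g"
  by (rule quotient_eqI[OF F.module_axioms submodule_tensor_null assms(2,3)])
    (unfold tensor_null_def, rule subsetD[OF generated_submodule_superset assms(1)])

lemma tensor_closed:
  "\<lbrakk>m \<in> carrier M; n \<in> carrier N\<rbrakk> \<Longrightarrow> tensor K M N m n \<in> carrier (tensor_product K M N)"
  unfolding tensor_def
  by (rule linear_map_closed[OF tensor_projection_linear pair_basis_closed])

text \<open>Each clause of bilinearity corresponds to one family of generators in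
  \<open>tensor_relations\<close>: the generator is the difference of the two sides, so both have
  the same coset.\<close>

lemma tensor_bilinear: "bilinear_map K M N (tensor_product K M N) (tensor K M N)"
proof -
  note add = linear_map_add[OF tensor_projection_linear]
    and smult = linear_map_smult[OF tensor_projection_linear]
  note cl = pair_basis_closed
  have "tensor K M N (m \<oplus>\<^bsub>M\<^esub> m') n
      = tensor K M N m n \<oplus>\<^bsub>tensor_product K M N\<^esub> tensor K M N m' n"
    if "m \<in> carrier M" "m' \<in> carrier M" "n \<in> carrier N" for m m' n
    unfolding tensor_def add[OF cl cl, OF that(1,3,2,3), symmetric] using that
    by (intro tensor_projection_eqI F.a_closed cl M.a_closed)
      (unfold tensor_relations_def Let_def Un_iff mem_Collect_eq, metis)
  moreover have "tensor K M N m (n \<oplus>\<^bsub>N\<^esub> n')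
      = tensor K M N m n \<oplus>\<^bsub>tensor_product K M N\<^esub> tensor K M N m n'"
    if "m \<in> carrier M" "n \<in> carrier N" "n' \<in> carrier N" for m n n'
    unfolding tensor_def add[OF cl cl, OF that(1,2,1,3), symmetric] using that
    by (intro tensor_projection_eqI F.a_closed cl N.a_closed)
      (unfold tensor_relations_def Let_def Un_iff mem_Collect_eq, metis)
  moreover have "tensor K M N (c \<odot>\<^bsub>M\<^esub> m) n = c \<odot>\<^bsub>tensor_product K M N\<^esub> tensor K M N m n"
    if "c \<in> carrier K" "m \<in> carrier M" "n \<in> carrier N" for c m n
    unfolding tensor_def smult[OF that(1) cl, OF that(2,3), symmetric] using that
    by (intro tensor_projection_eqI F.smult_closed cl M.smult_closed)
      (unfold tensor_relations_def Let_def Un_iff mem_Collect_eq, metis)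
  moreover have "tensor K M N m (c \<odot>\<^bsub>N\<^esub> n) = c \<odot>\<^bsub>tensor_product K M N\<^esub> tensor K M N m n"
    if "c \<in> carrier K" "m \<in> carrier M" "n \<in> carrier N" for c m n
    unfolding tensor_def smult[OF that(1) cl, OF that(2,3), symmetric] using that
    by (intro tensor_projection_eqI F.smult_closed cl N.smult_closed)
      (unfold tensor_relations_def Let_def Un_iff mem_Collect_eq, metis)
  ultimately show ?thesis
    by (intro bilinear_mapI linear_mapI) (simp_all add: tensor_closed)
qed

section \<open>Linear maps out of a tensor product\<close>

text \<open>Pure tensors span: pulled back to the free module, both maps are linear and agree on
  basis vectors. This is the device by which the later identities between linear maps are reduced to
  pure tensors.\<close>

lemma tensor_ext:
  assumes P: "module K P"
    and \<phi>: "linear_map K (tensor_product K M N) P \<phi>"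
    and \<psi>: "linear_map K (tensor_product K M N) P \<psi>"
    and eq: "\<And>m n. \<lbrakk>m \<in> carrier M; n \<in> carrier N\<rbrakk> \<Longrightarrow> \<phi> (tensor K M N m n) = \<psi> (tensor K M N m n)"
    and t: "t \<in> carrier (tensor_product K M N)"
  shows "\<phi> t = \<psi> t"
proof -
  note \<phi>p = linear_map_compose[OF \<phi> tensor_projection_linear]
  note \<psi>p = linear_map_compose[OF \<psi> tensor_projection_linear]
  note 0 = linear_map_zero[OF F.module_axioms P]
  from t obtain f where f: "f \<in> carrier (free_pairs K M N)" "t = proj f"
    by (auto simp: carrier_tensor_product)
  from M.R.cring_axioms f(1) have "\<phi> (proj f) = \<psi> (proj f)"
  proof (induction rule: free_module_induct)
    case zero
    show ?case using 0[OF \<phi>p] 0[OF \<psi>p] by simp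
  next
    case (add f g)
    then show ?case using linear_map_add[OF \<phi>p] linear_map_add[OF \<psi>p] by simp
  next
    case (basis c i)
    then have i: "free_basis K i \<in> carrier (free_pairs K M N)"
      and "\<phi> (proj (free_basis K i)) = \<psi> (proj (free_basis K i))"
      using eq[of "fst i" "snd i"] pair_basis_closed by (auto simp: tensor_def)
    with basis(1) show ?case
      using linear_map_smult[OF \<phi>p _ i] linear_map_smult[OF \<psi>p _ i] by simp
  qed
  with f show ?thesis by simp
qed

context
  fixes P :: "('k, 'p, 'u) module_scheme" and \<beta>
  assumes P: "module K P" and \<beta>: "bilinear_map K M N P \<beta>"
begin

interpretation P: module K P by (rule P)

private abbreviation (input) "lift \<equiv> free_lift K P (\<lambda>i. \<beta> (fst i) (snd i))"

private lemma \<beta>_Pi: "(\<lambda>i. \<beta> (fst i) (snd i)) \<in> carrier M \<times> carrier N \<rightarrow> carrier P"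
  using bilinear_map_closed[OF \<beta>] by auto

private lemma lift_linear: "linear_map K (free_pairs K M N) P lift"
  by (rule free_lift_linear[OF P \<beta>_Pi])

private lemma lift_basis:
  "\<lbrakk>m \<in> carrier M; n \<in> carrier N\<rbrakk> \<Longrightarrow> lift (free_basis K (m, n)) = \<beta> m n"
  using free_lift_basis[OF P \<beta>_Pi, of "(m, n)"] by simp

text \<open>The kernel of the linear extension is a submodule, and bilinearity of
  \<open>\<beta>\<close> puts every relation into it; hence it contains the generated
  submodule.\<close>

private lemma lift_null:
  assumes "f \<in> tensor_null K M N" shows "f \<in> carrier (free_pairs K M N)" "lift f = \<zero>\<^bsub>P\<^esub>"
proof -
  let ?H = "{f \<in> carrier (free_pairs K M N). lift f = \<zero>\<^bsub>P\<^esub>}"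
  note ker = submodule_kernel[OF F.module_axioms P lift_linear]
  have diff: "f \<ominus>\<^bsub>free_pairs K M N\<^esub> g \<in> ?H"
    if "f \<in> carrier (free_pairs K M N)" "g \<in> carrier (free_pairs K M N)" "lift f = lift g" for f g
  proof -
    have "lift f = lift ((f \<ominus>\<^bsub>free_pairs K M N\<^esub> g) \<oplus>\<^bsub>free_pairs K M N\<^esub> g)"
      using that by (simp add: F.minus_eq F.a_assoc F.l_neg)
    also have "\<dots> = lift (f \<ominus>\<^bsub>free_pairs K M N\<^esub> g) \<oplus>\<^bsub>P\<^esub> lift g"
      using that by (intro linear_map_add[OF lift_linear] F.minus_closed)
    finally have "lift (f \<ominus>\<^bsub>free_pairs K M N\<^esub> g) = \<zero>\<^bsub>P\<^esub>"
      using linear_map_closed[OF lift_linear that(2)]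
        linear_map_closed[OF lift_linear F.minus_closed[OF that(1,2)]] that(3)
      by (simp add: P.add.r_cancel_one P.add.r_cancel_one' P.add.l_cancel_one P.add.l_cancel_one')
    with F.minus_closed[OF that(1,2)] show ?thesis by simp
  qed
  have \<beta>1: "linear_map K N P (\<beta> m)" if "m \<in> carrier M" for m
    using \<beta> that by (auto simp: bilinear_map_def)
  have \<beta>2: "linear_map K M P (\<lambda>m. \<beta> m n)" if "n \<in> carrier N" for n
    using \<beta> that by (auto simp: bilinear_map_def)
  note lin = linear_map_add[OF lift_linear] linear_map_smult[OF lift_linear]
    linear_map_add[OF \<beta>1] linear_map_smult[OF \<beta>1] linear_map_add[OF \<beta>2] linear_map_smult[OF \<beta>2]
  have "tensor_relations K M N \<subseteq> ?H"
    unfolding tensor_relations_def Let_def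
    by (intro Un_least subsetI; elim CollectE exE conjE; hypsubst; intro diff;
        simp add: pair_basis_closed lin lift_basis bilinear_map_closed[OF \<beta>])
  with generated_submodule_least[OF ker] assms
  have "f \<in> ?H" unfolding tensor_null_def by blast
  then show "f \<in> carrier (free_pairs K M N)" "lift f = \<zero>\<^bsub>P\<^esub>" by auto
qed

text \<open>Representatives of one coset differ by a null element, on which the extension vanishes.
  The image of the coset is therefore a singleton and \<open>the_elem\<close> returns its
  member.\<close>

private lemma tensor_lift_projection:
  assumes f: "f \<in> carrier (free_pairs K M N)"
  shows "tensor_lift K M N P \<beta> (proj f) = lift f"
proof -
  have "lift g = lift f" if "g \<in> proj f" for g
  proof -
    from that obtain h where h: "h \<in> tensor_null K M N" "g = h \<oplus>\<^bsub>free_pairs K M N\<^esub> f"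
      by (auto simp: a_r_coset_def')
    with lift_null[OF h(1)] show ?thesis
      using linear_map_add[OF lift_linear, of h f] linear_map_closed[OF lift_linear] f by simp
  qed
  \<comment> \<open>Membership of \<open>f\<close> makes the image nonempty, as a singleton
    requires.\<close>
  moreover have "f \<in> proj f"
  proof -
    have "\<zero>\<^bsub>free_pairs K M N\<^esub> \<in> tensor_null K M N"
      using subgroup.one_closed[OF submodule.axioms(1)[OF submodule_tensor_null]] by simp
    then show ?thesis using f by (force simp: a_r_coset_def')
  qed
  ultimately have "lift ` proj f = {lift f}" by blast
  then show ?thesis by (simp add: tensor_lift_def free_lift_def)
qed

lemma tensor_lift_tensor:
  "\<lbrakk>m \<in> carrier M; n \<in> carrier N\<rbrakk> \<Longrightarrow> tensor_lift K M N P \<beta> (tensor K M N m n) = \<beta> m n"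
  unfolding tensor_def by (simp add: tensor_lift_projection pair_basis_closed lift_basis)

lemma tensor_lift_linear: "linear_map K (tensor_product K M N) P (tensor_lift K M N P \<beta>)"
proof -
  note lift_closed = linear_map_closed[OF lift_linear]
  note lin = linear_map_add[OF tensor_projection_linear] linear_map_smult[OF tensor_projection_linear]
    linear_map_add[OF lift_linear] linear_map_smult[OF lift_linear]
  show ?thesis
    by (rule linear_mapI)
      (auto simp: carrier_tensor_product tensor_lift_projection lift_closed lin simp flip: lin(1,2))
qed

end

end

text \<open>Here the tensor is fixed and the bilinear map varies. Both sides of each linearity
  clause are linear in \<open>t\<close>, so they need comparing on pure tensors only. Iterated lifts
  get their linearity in the outer variables from this.\<close>

lemma tensor_lift_linear_param:
  assumes M: "module K M" and N: "module K N" and P: "module K P" and A: "module K A"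
    and \<beta>: "\<And>a. a \<in> carrier A \<Longrightarrow> bilinear_map K M N P (\<beta> a)"
    and lin: "\<And>m n. \<lbrakk>m \<in> carrier M; n \<in> carrier N\<rbrakk> \<Longrightarrow> linear_map K A P (\<lambda>a. \<beta> a m n)"
    and t: "t \<in> carrier (tensor_product K M N)"
  shows "linear_map K A P (\<lambda>a. tensor_lift K M N P (\<beta> a) t)"
proof -
  interpret A: module K A by fact
  interpret P: module K P by fact
  note lift = tensor_lift_linear[OF M N P \<beta>] and ev = tensor_lift_tensor[OF M N P \<beta>]
  show ?thesis
  proof (rule linear_mapI)
    fix a assume "a \<in> carrier A"
    from linear_map_closed[OF lift[OF this] t] show "tensor_lift K M N P (\<beta> a) t \<in> carrier P" .
  next
    fix a b assume ab: "a \<in> carrier A" "b \<in> carrier A"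
    show "tensor_lift K M N P (\<beta> (a \<oplus>\<^bsub>A\<^esub> b)) t
        = tensor_lift K M N P (\<beta> a) t \<oplus>\<^bsub>P\<^esub> tensor_lift K M N P (\<beta> b) t"
      by (rule tensor_ext[OF M N P _ _ _ t, of "tensor_lift K M N P (\<beta> (a \<oplus>\<^bsub>A\<^esub> b))"
            "\<lambda>t. tensor_lift K M N P (\<beta> a) t \<oplus>\<^bsub>P\<^esub> tensor_lift K M N P (\<beta> b) t"])
        (use ab in \<open>auto intro!: lift linear_map_plus P simp: ev linear_map_add[OF lin]\<close>)
  next
    fix c a assume ca: "c \<in> carrier K" "a \<in> carrier A"
    show "tensor_lift K M N P (\<beta> (c \<odot>\<^bsub>A\<^esub> a)) t = c \<odot>\<^bsub>P\<^esub> tensor_lift K M N P (\<beta> a) t"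
      by (rule tensor_ext[OF M N P _ _ _ t, of "tensor_lift K M N P (\<beta> (c \<odot>\<^bsub>A\<^esub> a))"
            "\<lambda>t. c \<odot>\<^bsub>P\<^esub> tensor_lift K M N P (\<beta> a) t"])
        (use ca in \<open>auto intro!: lift linear_map_scale P simp: ev linear_map_smult[OF lin]\<close>)
  qed
qed

section \<open>Tensor products of linear maps\<close>

lemma linear_map_id: "linear_map K M M id"
  by (simp add: linear_map_def)

context
  fixes K :: "('k, 'r) ring_scheme" and M :: "('k, 'm, 's) module_scheme"
    and N :: "('k, 'n, 't) module_scheme" and P :: "('k, 'p, 'u) module_scheme"
    and Q :: "('k, 'q, 'v) module_scheme" and f g
  assumes M: "module K M" and N: "module K N" and P: "module K P" and Q: "module K Q"
    and f: "linear_map K M P f" and g: "linear_map K N Q g"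
begin

private lemma tensor_map_bilinear:
  "bilinear_map K M N (tensor_product K P Q) (\<lambda>m n. tensor K P Q (f m) (g n))"
  by (intro bilinear_mapI bilinear_map_left[OF tensor_bilinear[OF P Q] f]
      bilinear_map_right[OF tensor_bilinear[OF P Q] _ g] linear_map_closed[OF f] linear_map_closed[OF g])

lemma tensor_map_linear:
  "linear_map K (tensor_product K M N) (tensor_product K P Q) (tensor_map K M N P Q f g)"
  unfolding tensor_map_def
  by (rule tensor_lift_linear[OF M N module_tensor_product[OF P Q] tensor_map_bilinear])

lemma tensor_map_tensor:
  "\<lbrakk>m \<in> carrier M; n \<in> carrier N\<rbrakk>
    \<Longrightarrow> tensor_map K M N P Q f g (tensor K M N m n) = tensor K P Q (f m) (g n)"
  unfolding tensor_map_def
  by (rule tensor_lift_tensor[OF M N module_tensor_product[OF P Q] tensor_map_bilinear])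

end

section \<open>Triple tensor products and the associator\<close>

text \<open>The asymmetric form follows the nesting in \<open>tensor_lift3\<close>, whose inner lift
  treats the last two arguments; \<open>trilinear_mapI\<close> restores the symmetric view.\<close>

definition trilinear_map ::
    "('k, 'r) ring_scheme \<Rightarrow> ('k, 'm, 's) module_scheme \<Rightarrow> ('k, 'n, 't) module_scheme
      \<Rightarrow> ('k, 'p, 'u) module_scheme \<Rightarrow> ('k, 'q, 'v) module_scheme \<Rightarrow> ('m \<Rightarrow> 'n \<Rightarrow> 'p \<Rightarrow> 'q) \<Rightarrow> bool" where
  "trilinear_map K M N P Q \<phi> \<longleftrightarrow>
     (\<forall>m\<in>carrier M. bilinear_map K N P Q (\<phi> m)) \<and>
     (\<forall>n\<in>carrier N. \<forall>p\<in>carrier P. linear_map K M Q (\<lambda>m. \<phi> m n p))"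

lemma trilinear_mapI:
  assumes "\<And>n p. \<lbrakk>n \<in> carrier N; p \<in> carrier P\<rbrakk> \<Longrightarrow> linear_map K M Q (\<lambda>m. \<phi> m n p)"
    and "\<And>m p. \<lbrakk>m \<in> carrier M; p \<in> carrier P\<rbrakk> \<Longrightarrow> linear_map K N Q (\<lambda>n. \<phi> m n p)"
    and "\<And>m n. \<lbrakk>m \<in> carrier M; n \<in> carrier N\<rbrakk> \<Longrightarrow> linear_map K P Q (\<lambda>p. \<phi> m n p)"
  shows "trilinear_map K M N P Q \<phi>"
  using assms by (auto simp: trilinear_map_def intro: bilinear_mapI)

lemma trilinear_map_bilinear:
  "\<lbrakk>trilinear_map K M N P Q \<phi>; m \<in> carrier M\<rbrakk> \<Longrightarrow> bilinear_map K N P Q (\<phi> m)"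
  by (simp add: trilinear_map_def)

lemma trilinear_map_linear:
  "\<lbrakk>trilinear_map K M N P Q \<phi>; n \<in> carrier N; p \<in> carrier P\<rbrakk> \<Longrightarrow> linear_map K M Q (\<lambda>m. \<phi> m n p)"
  by (simp add: trilinear_map_def)

context
  fixes K :: "('k, 'r) ring_scheme" and M :: "('k, 'm, 's) module_scheme"
    and N :: "('k, 'n, 't) module_scheme" and P :: "('k, 'p, 'u) module_scheme"
  assumes M: "module K M" and N: "module K N" and P: "module K P"
begin

private lemma NP: "module K (tensor_product K N P)"
  by (rule module_tensor_product[OF N P])

private lemma tensor_lift3_bilinear:
  assumes Q: "module K Q" and \<phi>: "trilinear_map K M N P Q \<phi>"
  shows "bilinear_map K M (tensor_product K N P) Q (\<lambda>m. tensor_lift K N P Q (\<phi> m))"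
  by (rule bilinear_mapI, rule tensor_lift_linear[OF N P Q trilinear_map_bilinear[OF \<phi>]], assumption)
    (rule tensor_lift_linear_param[OF N P Q M trilinear_map_bilinear[OF \<phi>] trilinear_map_linear[OF \<phi>]])

lemma tensor_lift3_linear:
  assumes Q: "module K Q" and \<phi>: "trilinear_map K M N P Q \<phi>"
  shows "linear_map K (tensor_product K M (tensor_product K N P)) Q (tensor_lift3 K M N P Q \<phi>)"
  unfolding tensor_lift3_def
  by (rule tensor_lift_linear[OF M NP Q tensor_lift3_bilinear[OF Q \<phi>]])

lemma tensor_lift3_tensor:
  assumes Q: "module K Q" and \<phi>: "trilinear_map K M N P Q \<phi>"
    and "m \<in> carrier M" "n \<in> carrier N" "p \<in> carrier P"
  shows "tensor_lift3 K M N P Q \<phi> (tensor K M (tensor_product K N P) m (tensor K N P n p)) = \<phi> m n p"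
proof -
  from \<phi> assms(3) have "bilinear_map K N P Q (\<phi> m)" by (simp add: trilinear_map_def)
  from tensor_lift_tensor[OF N P Q this assms(4,5)] show ?thesis
    unfolding tensor_lift3_def
    by (subst tensor_lift_tensor[OF M NP Q tensor_lift3_bilinear[OF Q \<phi>] assms(3)])
      (simp_all add: tensor_closed[OF N P assms(4,5)])
qed

text \<open>Meant for nested Sweedler sums: the inner sum, taken at a fixed triple tensor, has to be
  linear in the components of the outer one.\<close>

lemma tensor_lift3_linear_param:
  assumes Q: "module K Q" and A: "module K A"
    and \<phi>: "\<And>a. a \<in> carrier A \<Longrightarrow> trilinear_map K M N P Q (\<phi> a)"
    and lin: "\<And>m n p. \<lbrakk>m \<in> carrier M; n \<in> carrier N; p \<in> carrier P\<rbrakk> \<Longrightarrow> linear_map K A Q (\<lambda>a. \<phi> a m n p)"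
    and t: "t \<in> carrier (tensor_product K M (tensor_product K N P))"
  shows "linear_map K A Q (\<lambda>a. tensor_lift3 K M N P Q (\<phi> a) t)"
  unfolding tensor_lift3_def
  by (rule tensor_lift_linear_param[OF M NP Q A tensor_lift3_bilinear[OF Q \<phi>] _ t], assumption)
    (rule tensor_lift_linear_param[OF N P Q A trilinear_map_bilinear[OF \<phi>] lin])

private abbreviation (input) "MN_P \<equiv> tensor_product K (tensor_product K M N) P"
private abbreviation (input) "M_NP \<equiv> tensor_product K M (tensor_product K N P)"

private lemma MN: "module K (tensor_product K M N)"
  by (rule module_tensor_product[OF M N])

lemmas module_tensor_product3 = module_tensor_product[OF MN P] module_tensor_product[OF M NP]

private lemma assoc_inner_bilinear:
  assumes "p \<in> carrier P"
  shows "bilinear_map K M N M_NP (\<lambda>m n. tensor K M (tensor_product K N P) m (tensor K N P n p))"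
  by (intro bilinear_mapI bilinear_map_left[OF tensor_bilinear[OF M NP]]
      bilinear_map_right[OF tensor_bilinear[OF M NP]] bilinear_map_left[OF tensor_bilinear[OF N P]]
      linear_map_ident tensor_closed[OF N P] assms)

private lemma assoc_bilinear:
  "bilinear_map K (tensor_product K M N) P M_NP
    (\<lambda>s p. tensor_lift K M N M_NP
      (\<lambda>m n. tensor K M (tensor_product K N P) m (tensor K N P n p)) s)"
  by (intro bilinear_mapI tensor_lift_linear[OF M N module_tensor_product3(2)]
      tensor_lift_linear_param[OF M N module_tensor_product3(2) P] assoc_inner_bilinear
      bilinear_map_right[OF tensor_bilinear[OF M NP]] bilinear_map_right[OF tensor_bilinear[OF N P]]
      linear_map_ident)

lemma tensor_assoc_linear: "linear_map K MN_P M_NP (tensor_assoc K M N P)"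
  unfolding tensor_assoc_def Let_def
  by (rule tensor_lift_linear[OF MN P module_tensor_product3(2) assoc_bilinear])

lemma tensor_assoc_tensor:
  assumes "m \<in> carrier M" "n \<in> carrier N" "p \<in> carrier P"
  shows "tensor_assoc K M N P (tensor K (tensor_product K M N) P (tensor K M N m n) p)
    = tensor K M (tensor_product K N P) m (tensor K N P n p)"
  unfolding tensor_assoc_def Let_def
  by (simp only: assms tensor_lift_tensor[OF MN P module_tensor_product3(2) assoc_bilinear]
      tensor_closed[OF M N] tensor_lift_tensor[OF M N module_tensor_product3(2) assoc_inner_bilinear])

private lemma assoc_inv_trilinear:
  "trilinear_map K M N P MN_P
    (\<lambda>m n p. tensor K (tensor_product K M N) P (tensor K M N m n) p)"
  by (intro trilinear_mapI bilinear_map_left[OF tensor_bilinear[OF MN P]]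
      bilinear_map_right[OF tensor_bilinear[OF MN P]] bilinear_map_left[OF tensor_bilinear[OF M N]]
      bilinear_map_right[OF tensor_bilinear[OF M N]]
      linear_map_ident tensor_closed[OF M N])

lemma tensor_assoc_inv_linear: "linear_map K M_NP MN_P (tensor_assoc_inv K M N P)"
  unfolding tensor_assoc_inv_def
  by (rule tensor_lift3_linear[OF module_tensor_product3(1) assoc_inv_trilinear])

lemma tensor_assoc_inv_tensor:
  assumes "m \<in> carrier M" "n \<in> carrier N" "p \<in> carrier P"
  shows "tensor_assoc_inv K M N P (tensor K M (tensor_product K N P) m (tensor K N P n p))
    = tensor K (tensor_product K M N) P (tensor K M N m n) p"
  unfolding tensor_assoc_inv_def
  by (rule tensor_lift3_tensor[OF module_tensor_product3(1) assoc_inv_trilinear assms])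

lemma tensor_ext3:
  assumes Q: "module K Q"
    and \<phi>: "linear_map K M_NP Q \<phi>" and \<psi>: "linear_map K M_NP Q \<psi>"
    and eq: "\<And>m n p. \<lbrakk>m \<in> carrier M; n \<in> carrier N; p \<in> carrier P\<rbrakk>
      \<Longrightarrow> \<phi> (tensor K M (tensor_product K N P) m (tensor K N P n p))
        = \<psi> (tensor K M (tensor_product K N P) m (tensor K N P n p))"
    and t: "t \<in> carrier M_NP"
  shows "\<phi> t = \<psi> t"
proof (rule tensor_ext[OF M NP Q \<phi> \<psi> _ t])
  fix m s assume m: "m \<in> carrier M" and s: "s \<in> carrier (tensor_product K N P)"
  note lin = bilinear_map_right[OF tensor_bilinear[OF M NP] m linear_map_ident]
  show "\<phi> (tensor K M (tensor_product K N P) m s) = \<psi> (tensor K M (tensor_product K N P) m s)"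
    by (rule tensor_ext[OF N P Q linear_map_compose[OF \<phi> lin] linear_map_compose[OF \<psi> lin] eq[OF m] s])
qed

text \<open>This composite arises when \<open>R2\<close>, which begins with the associator, is
  applied to an element brought back by \<open>tensor_assoc_inv\<close>.\<close>

lemma tensor_assoc_assoc_inv:
  assumes "t \<in> carrier M_NP"
  shows "tensor_assoc K M N P (tensor_assoc_inv K M N P t) = t"
  by (rule tensor_ext3[OF module_tensor_product3(2)
        linear_map_compose[OF tensor_assoc_linear tensor_assoc_inv_linear] linear_map_ident _ assms])
    (simp add: tensor_assoc_inv_tensor tensor_assoc_tensor)

end

section \<open>Diagonal actions\<close>

text \<open>The Leibniz extension of \<open>f\<close>: if a Lie algebra element acts on
  \<open>M\<close> as \<open>f\<close>, this is its action on the tensor square.\<close>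

definition tensor_diag ::
    "('k, 'r) ring_scheme \<Rightarrow> ('k, 'm, 's) module_scheme \<Rightarrow> ('m \<Rightarrow> 'm)
      \<Rightarrow> ('m \<times> 'm \<Rightarrow> 'k) set \<Rightarrow> ('m \<times> 'm \<Rightarrow> 'k) set" where
  "tensor_diag K M f t =
     tensor_map K M M M M f id t \<oplus>\<^bsub>tensor_product K M M\<^esub> tensor_map K M M M M id f t"

lemma tensor_diag_linear:
  assumes "module K M" "linear_map K M M f"
  shows "linear_map K (tensor_product K M M) (tensor_product K M M) (tensor_diag K M f)"
  unfolding tensor_diag_def[abs_def]
  by (intro linear_map_plus module_tensor_product tensor_map_linear linear_map_id assms)

lemma tensor_diag_tensor:
  assumes "module K M" "linear_map K M M f" "m \<in> carrier M" "n \<in> carrier M"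
  shows "tensor_diag K M f (tensor K M M m n)
    = tensor K M M (f m) n \<oplus>\<^bsub>tensor_product K M M\<^esub> tensor K M M m (f n)"
  by (simp add: tensor_diag_def tensor_map_tensor linear_map_id assms)

lemma tensor_diag_bilinear:
  assumes M: "module K M" and A: "module K A" and E: "bilinear_map K A M M E"
  shows "bilinear_map K A (tensor_product K M M) (tensor_product K M M) (\<lambda>s. tensor_diag K M (E s))"
proof (rule bilinear_mapI)
  have E': "linear_map K M M (E s)" if "s \<in> carrier A" for s
    using E that by (simp add: bilinear_map_def)
  then show "linear_map K (tensor_product K M M) (tensor_product K M M) (tensor_diag K M (E s))"
    if "s \<in> carrier A" for s using that by (intro tensor_diag_linear M)
  fix t assume t: "t \<in> carrier (tensor_product K M M)"
  note T = module_tensor_product[OF M M]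
  note lin = bilinear_map_left[OF tensor_bilinear[OF M M]] bilinear_map_right[OF tensor_bilinear[OF M M]]
  show "linear_map K A (tensor_product K M M) (\<lambda>s. tensor_diag K M (E s) t)"
    \<comment> \<open>The tensor \<open>t\<close> is fixed while the mapped functions vary with
      \<open>s\<close>, so both summands are opened to lifts with a parameter.\<close>
    unfolding tensor_diag_def tensor_map_def id_apply
    by (intro linear_map_plus[OF T] tensor_lift_linear_param[OF M M T A _ _ t] bilinear_mapI lin
        linear_map_ident bilinear_map_left[OF E] E' linear_map_closed[OF E'])
qed

section \<open>The coalgebra of a Lie algebra\<close>

context lie_algebra
begin

abbreviation "X \<equiv> lie_X K L"
abbreviation "V \<equiv> tensor_product K X X"
abbreviation "one_X \<equiv> (\<one>\<^bsub>K\<^esub>, \<zero>\<^bsub>L\<^esub>)"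
abbreviation "prim (s :: 'l) \<equiv> (\<zero>\<^bsub>K\<^esub>, s)"

lemma lie_X_simps [simp]:
  "carrier X = carrier K \<times> carrier L"
  "\<zero>\<^bsub>X\<^esub> = (\<zero>\<^bsub>K\<^esub>, \<zero>\<^bsub>L\<^esub>)"
  "(a, x) \<oplus>\<^bsub>X\<^esub> (b, y) = (a \<oplus>\<^bsub>K\<^esub> b, x \<oplus>\<^bsub>L\<^esub> y)"
  "c \<odot>\<^bsub>X\<^esub> (a, x) = (c \<otimes>\<^bsub>K\<^esub> a, c \<odot>\<^bsub>L\<^esub> x)"
  by (simp_all add: lie_X_def)

lemma module_X: "module K X"
proof (rule moduleI)
  show "cring K" by (rule K.cring_axioms)
  show "abelian_group X"
  proof (rule abelian_groupI)
    fix u assume "u \<in> carrier X"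
    then show "\<exists>v\<in>carrier X. v \<oplus>\<^bsub>X\<^esub> u = \<zero>\<^bsub>X\<^esub>"
      by (intro bexI[of _ "(\<ominus>\<^bsub>K\<^esub> fst u, \<ominus>\<^bsub>L\<^esub> snd u)"]) (auto simp: K.l_neg L.M.l_neg)
  qed (auto simp: K.a_ac L.M.a_ac)
qed (auto simp: K.l_distr K.r_distr K.m_assoc L.smult_l_distr L.smult_r_distr L.smult_assoc1)

lemma module_V: "module K V"
  by (rule module_tensor_product[OF module_X module_X])

lemma module_L: "module K L"
  by unfold_locales

lemma one_X_closed: "one_X \<in> carrier X"
  by simp

lemma prim_closed: "s \<in> carrier L \<Longrightarrow> prim s \<in> carrier X"
  by simp

lemma prim_linear: "linear_map K L X prim"
  by (rule linear_mapI) auto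

lemma snd_linear: "linear_map K X L snd"
  by (rule linear_mapI) auto

lemma snd_closed: "z \<in> carrier X \<Longrightarrow> snd z \<in> carrier L"
  by auto

lemma br_right_linear: "x \<in> carrier L \<Longrightarrow> linear_map K L L (br x)"
  and br_left_linear: "y \<in> carrier L \<Longrightarrow> linear_map K L L (\<lambda>x. br x y)"
  using br_bilinear by (auto simp: bilinear_map_def)

lemma br_closed [simp]: "\<lbrakk>x \<in> carrier L; y \<in> carrier L\<rbrakk> \<Longrightarrow> br x y \<in> carrier L"
  by (rule bilinear_map_closed[OF br_bilinear])

lemmas br_add = linear_map_add[OF br_right_linear] linear_map_add[OF br_left_linear]
  and br_smult = linear_map_smult[OF br_right_linear] linear_map_smult[OF br_left_linear]
  and br_zero [simp] = linear_map_zero[OF module_L module_L br_right_linear]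
    linear_map_zero[OF module_L module_L br_left_linear]

text \<open>Polarisation: expand the vanishing bracket of \<open>x\<close> plus \<open>y\<close>
  with itself.\<close>

lemma br_anti:
  assumes "x \<in> carrier L" "y \<in> carrier L"
  shows "br x y \<oplus>\<^bsub>L\<^esub> br y x = \<zero>\<^bsub>L\<^esub>"
proof -
  have "br x y \<oplus>\<^bsub>L\<^esub> br y x = br (x \<oplus>\<^bsub>L\<^esub> y) (x \<oplus>\<^bsub>L\<^esub> y)"
    using assms br_alternating[OF assms(1)] br_alternating[OF assms(2)]
    by (simp add: br_add L.M.a_comm)
  with assms show ?thesis by (simp add: br_alternating)
qed

text \<open>The Jacobi identity, rearranged by antisymmetry so that bracketing with \<open>s\<close>
  on the right appears as a derivation. All later uses of the Jacobi identity pass through this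
  form.\<close>

lemma br_leibniz:
  assumes "x \<in> carrier L" "t \<in> carrier L" "s \<in> carrier L"
  shows "br (br x t) s = br (br x s) t \<oplus>\<^bsub>L\<^esub> br x (br t s)"
proof -
  have minus: "br x y = \<ominus>\<^bsub>L\<^esub> br y x" if "x \<in> carrier L" "y \<in> carrier L" for x y
    using br_anti[OF that] that by (simp add: L.M.minus_equality)
  have neg: "br x (\<ominus>\<^bsub>L\<^esub> y) = \<ominus>\<^bsub>L\<^esub> br x y" if "x \<in> carrier L" "y \<in> carrier L" for x y
  proof -
    have "br x (\<ominus>\<^bsub>L\<^esub> y) \<oplus>\<^bsub>L\<^esub> br x y = \<zero>\<^bsub>L\<^esub>"
      using that by (simp add: L.M.l_neg flip: br_add)
    then show ?thesis using that by (simp add: L.M.minus_equality)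
  qed
  have "br (br x t) s = \<ominus>\<^bsub>L\<^esub> br s (br x t)"
    using assms by (intro minus) auto
  also have "\<dots> = br x (br t s) \<oplus>\<^bsub>L\<^esub> br t (br s x)"
    \<comment> \<open>The Jacobi identity for \<open>x\<close>, \<open>t\<close>, \<open>s\<close>
      exhibits the right-hand side as the additive inverse of \<open>br s (br x t)\<close>.\<close>
    by (rule L.M.minus_equality) (use assms br_jacobi[OF assms] in auto)
  also have "br t (br s x) = br (br x s) t"
    using assms minus[of t "br s x"] minus[of "br x s" t] minus[of s x] neg[of t "br x s"] by simp
  finally show ?thesis using assms by (simp add: L.M.a_comm)
qed

lemma smult_left_comm:
  "\<lbrakk>a \<in> carrier K; b \<in> carrier K; x \<in> carrier L\<rbrakk> \<Longrightarrow> a \<odot>\<^bsub>L\<^esub> (b \<odot>\<^bsub>L\<^esub> x) = b \<odot>\<^bsub>L\<^esub> (a \<odot>\<^bsub>L\<^esub> x)"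
  by (simp add: K.m_comm flip: L.smult_assoc1)

section \<open>The binary operation on X and its iterate T\<close>

text \<open>The self-distributive product attached to a Lie algebra, a linearised rack operation. It
  is read as a right action of the second argument on the first.\<close>

definition lie_q :: "'k \<times> 'l \<Rightarrow> 'k \<times> 'l \<Rightarrow> 'k \<times> 'l" where
  "lie_q = (\<lambda>(a, x) (b, y). (a \<otimes>\<^bsub>K\<^esub> b, b \<odot>\<^bsub>L\<^esub> x \<oplus>\<^bsub>L\<^esub> br x y))"

lemma lie_q_bilinear: "bilinear_map K X X X lie_q"
proof (rule bilinear_mapI)
  fix m assume "m \<in> carrier X"
  then show "linear_map K X X (lie_q m)"
    by (intro linear_mapI)
      (auto simp: lie_q_def K.r_distr K.m_ac L.smult_l_distr L.smult_r_distr br_add br_smult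
        L.M.a_ac L.smult_assoc1)
next
  fix n assume "n \<in> carrier X"
  then show "linear_map K X X (\<lambda>m. lie_q m n)"
    by (intro linear_mapI)
      (auto simp: lie_q_def K.l_distr K.r_distr K.m_ac L.smult_l_distr L.smult_r_distr br_add br_smult
        L.M.a_ac K.m_comm simp flip: L.smult_assoc1)
qed

lemma lie_q_closed: "\<lbrakk>x \<in> carrier X; y \<in> carrier X\<rbrakk> \<Longrightarrow> lie_q x y \<in> carrier X"
  by (rule bilinear_map_closed[OF lie_q_bilinear])

lemma lie_q_one: "x \<in> carrier X \<Longrightarrow> lie_q x one_X = x"
  by (auto simp: lie_q_def)

lemma lie_q_one_prim: "s \<in> carrier L \<Longrightarrow> lie_q one_X (prim s) = \<zero>\<^bsub>X\<^esub>"
  by (auto simp: lie_q_def)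

text \<open>Acting by a primitive element annihilates the scalar component, so only
  \<open>br_leibniz\<close> in the Lie component remains.\<close>

lemma lie_q_leibniz:
  "\<lbrakk>x \<in> carrier X; t \<in> carrier L; s \<in> carrier L\<rbrakk> \<Longrightarrow>
    lie_q (lie_q x (prim t)) (prim s) =
      lie_q (lie_q x (prim s)) (prim t) \<oplus>\<^bsub>X\<^esub> lie_q x (prim (br t s))"
  using br_leibniz[of "snd x" t s] by (auto simp: lie_q_def)

text \<open>A verbatim copy of the function lifted in \<open>lie_T\<close>, so that facts about it
  apply once \<open>lie_T\<close> is unfolded.\<close>

abbreviation lie_T_kernel where
  "lie_T_kernel \<equiv> \<lambda>(a, x) (b, y) (c, z).
         (a \<otimes>\<^bsub>K\<^esub> b \<otimes>\<^bsub>K\<^esub> c,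
          (b \<otimes>\<^bsub>K\<^esub> c) \<odot>\<^bsub>L\<^esub> x \<oplus>\<^bsub>L\<^esub> c \<odot>\<^bsub>L\<^esub> br x y \<oplus>\<^bsub>L\<^esub> b \<odot>\<^bsub>L\<^esub> br x z
            \<oplus>\<^bsub>L\<^esub> br (br x y) z)"

text \<open>Expanding \<open>c (b x + [x, y]) + [b x + [x, y], z]\<close> gives the four summands of
  the Lie component.\<close>

lemma lie_T_kernel_eq:
  "\<lbrakk>x \<in> carrier X; y \<in> carrier X; z \<in> carrier X\<rbrakk> \<Longrightarrow> lie_T_kernel x y z = lie_q (lie_q x y) z"
  by (auto simp: lie_q_def br_add br_smult L.smult_r_distr L.smult_assoc1 L.M.a_ac smult_left_comm)

text \<open>Inherited from the bilinearity of \<open>lie_q\<close> by rewriting the kernel as an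
  iterated product.\<close>

lemma lie_T_kernel_trilinear: "trilinear_map K X X X X lie_T_kernel"
proof (rule trilinear_mapI)
  fix y z assume "y \<in> carrier X" "z \<in> carrier X"
  then show "linear_map K X X (\<lambda>x. lie_T_kernel x y z)"
    by (subst linear_map_cong[OF module_X lie_T_kernel_eq])
      (auto intro!: bilinear_map_left[OF lie_q_bilinear] linear_map_ident)
next
  fix x z assume "x \<in> carrier X" "z \<in> carrier X"
  then show "linear_map K X X (\<lambda>y. lie_T_kernel x y z)"
    by (subst linear_map_cong[OF module_X lie_T_kernel_eq])
      (auto intro!: bilinear_map_left[OF lie_q_bilinear] bilinear_map_right[OF lie_q_bilinear]
        linear_map_ident)
next
  fix x y assume "x \<in> carrier X" "y \<in> carrier X"
  then show "linear_map K X X (\<lambda>z. lie_T_kernel x y z)"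
    by (subst linear_map_cong[OF module_X lie_T_kernel_eq])
      (auto intro!: bilinear_map_right[OF lie_q_bilinear] lie_q_closed linear_map_ident simp del: lie_X_simps)
qed

lemma lie_T_linear: "linear_map K (tensor_product K X V) X (lie_T K L br)"
  unfolding lie_T_def Let_def
  by (rule tensor_lift3_linear[OF module_X module_X module_X module_X lie_T_kernel_trilinear])

lemma lie_T_tensor:
  assumes "x \<in> carrier X" "y \<in> carrier X" "z \<in> carrier X"
  shows "lie_T K L br (tensor K X V x (tensor K X X y z)) = lie_q (lie_q x y) z"
  unfolding lie_T_def Let_def
  by (subst tensor_lift3_tensor[OF module_X module_X module_X module_X lie_T_kernel_trilinear assms])
    (rule lie_T_kernel_eq[OF assms])

declare lie_X_simps [simp del]

lemmas tensor_XX_linear = bilinear_map_left[OF tensor_bilinear[OF module_X module_X]]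
    bilinear_map_right[OF tensor_bilinear[OF module_X module_X]]
  and tensor_XV_linear = bilinear_map_left[OF tensor_bilinear[OF module_X module_V]]
    bilinear_map_right[OF tensor_bilinear[OF module_X module_V]]

section \<open>The comultiplication and its iterate\<close>

text \<open>Replacing pattern matching by \<open>snd\<close> displays the map as a composite of
  linear maps.\<close>

lemma lie_Delta_eq:
  "lie_Delta K L = (\<lambda>z. tensor K X X z one_X \<oplus>\<^bsub>V\<^esub> tensor K X X one_X (prim (snd z)))"
  by (auto simp: lie_Delta_def Let_def fun_eq_iff)

lemma lie_Delta_linear: "linear_map K X V (lie_Delta K L)"
  unfolding lie_Delta_eq
  by (intro linear_map_plus module_V tensor_XX_linear linear_map_ident one_X_closed
      linear_map_compose[OF prim_linear snd_linear])

text \<open>\<open>one_X\<close> is grouplike and \<open>p\<close> is primitive, so applying the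
  comultiplication to the second leg splits only the term that carries \<open>p\<close>.\<close>

lemma lie_Delta3_eq:
  assumes "z \<in> carrier X"
  defines "p \<equiv> prim (snd z)"
  shows "lie_Delta3 K L z =
    tensor K X V z (tensor K X X one_X one_X) \<oplus>\<^bsub>tensor_product K X V\<^esub>
    (tensor K X V one_X (tensor K X X p one_X) \<oplus>\<^bsub>tensor_product K X V\<^esub>
     tensor K X V one_X (tensor K X X one_X p))"
proof -
  interpret X: module K X by (rule module_X)
  interpret V: module K V by (rule module_V)
  note closed = one_X_closed assms(1) prim_closed[OF snd_closed[OF assms(1)], folded p_def]
  note tcl = tensor_closed[OF module_X module_X] tensor_closed[OF module_X module_V]
  note map = tensor_map_linear[OF module_X module_X module_X module_V linear_map_id lie_Delta_linear]
    and map_tensor =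
      tensor_map_tensor[OF module_X module_X module_X module_V linear_map_id lie_Delta_linear]
  have zero: "tensor K X X x \<zero>\<^bsub>X\<^esub> = \<zero>\<^bsub>V\<^esub>" if "x \<in> carrier X" for x
    by (rule linear_map_zero[OF module_X module_V tensor_XX_linear(2)[OF that linear_map_ident]])
  have [simp]: "prim \<zero>\<^bsub>L\<^esub> = \<zero>\<^bsub>X\<^esub>" by (simp add: lie_X_simps)
  \<comment> \<open>The second summand contains \<open>prim\<close> of zero, which is the zero of
    \<open>X\<close>, and vanishes.\<close>
  have Delta_one: "lie_Delta K L one_X = tensor K X X one_X one_X"
    using closed tcl by (simp add: lie_Delta_eq zero)
  have Delta_p: "lie_Delta K L p = tensor K X X p one_X \<oplus>\<^bsub>V\<^esub> tensor K X X one_X p"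
    by (simp add: lie_Delta_eq p_def)
  have "lie_Delta3 K L z = tensor_map K X X X V id (lie_Delta K L)
      (tensor K X X z one_X \<oplus>\<^bsub>V\<^esub> tensor K X X one_X p)"
    by (simp add: lie_Delta3_def Let_def lie_Delta_eq[THEN fun_cong] p_def)
  also have "\<dots> = tensor K X V z (lie_Delta K L one_X)
      \<oplus>\<^bsub>tensor_product K X V\<^esub> tensor K X V one_X (lie_Delta K L p)"
    using closed tcl by (simp add: linear_map_add[OF map] map_tensor)
  finally show ?thesis
    using closed tcl
    by (simp add: Delta_one Delta_p linear_map_add[OF tensor_XV_linear(2)[OF _ linear_map_ident]])
qed

section \<open>The braid equation\<close>

abbreviation "VV \<equiv> tensor_product K V V"
abbreviation "tX \<equiv> tensor K X X"
abbreviation "tV \<equiv> tensor K V V"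

section \<open>The action of L on X and on its tensor powers\<close>

text \<open>Explicitly \<open>(a, x)\<close> goes to \<open>(0, [x, s])\<close>: the right adjoint
  action on \<open>L\<close>, extended by zero on scalars. The acting element comes first so that
  \<open>act_X s\<close> can be fed to \<open>tensor_diag\<close>.\<close>

definition act_X :: "'l \<Rightarrow> 'k \<times> 'l \<Rightarrow> 'k \<times> 'l" where
  "act_X s x = lie_q x (prim s)"

abbreviation "act_V s \<equiv> tensor_diag K X (act_X s)"
abbreviation "act_VV s \<equiv> tensor_diag K V (act_V s)"

lemma module_VV: "module K VV"
  by (rule module_tensor_product[OF module_V module_V])

lemma act_X_bilinear: "bilinear_map K L X X act_X"
  unfolding act_X_def[abs_def]
  by (intro bilinear_mapI bilinear_map_left[OF lie_q_bilinear] bilinear_map_right[OF lie_q_bilinear]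
      linear_map_ident prim_linear prim_closed)

lemma act_V_bilinear: "bilinear_map K L V V act_V"
  by (rule tensor_diag_bilinear[OF module_X module_L act_X_bilinear])

lemma act_VV_bilinear: "bilinear_map K L VV VV act_VV"
  by (rule tensor_diag_bilinear[OF module_V module_L act_V_bilinear])

lemma act_X_linear: "s \<in> carrier L \<Longrightarrow> linear_map K X X (act_X s)"
  and act_V_linear: "s \<in> carrier L \<Longrightarrow> linear_map K V V (act_V s)"
  and act_VV_linear: "s \<in> carrier L \<Longrightarrow> linear_map K VV VV (act_VV s)"
  using act_X_bilinear act_V_bilinear act_VV_bilinear by (simp_all add: bilinear_map_def)

lemmas act_closed = bilinear_map_closed[OF act_X_bilinear] bilinear_map_closed[OF act_V_bilinear]
  bilinear_map_closed[OF act_VV_bilinear]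

lemmas act_tensor = tensor_diag_tensor[OF module_X act_X_linear]
  tensor_diag_tensor[OF module_V act_V_linear]

lemmas tX_closed = tensor_closed[OF module_X module_X]
  and tV_closed = tensor_closed[OF module_V module_V]

lemmas tensor_VV_linear = bilinear_map_left[OF tensor_bilinear[OF module_V module_V]]
    bilinear_map_right[OF tensor_bilinear[OF module_V module_V]]

text \<open>
  For a space \<open>W\<close> acted on by \<open>L\<close> this is the closed form of
  \<open>z\<^sup>1 \<otimes> w\<^sup>1 \<otimes> (t \<triangleleft> z\<^sup>2) \<triangleleft> w\<^sup>2\<close>, where \<open>t \<triangleleft> (a, p) = a t + E p t\<close>.  For \<open>W = V\<close> it is the operator
  \<open>R\<close>, and for \<open>W = V \<otimes> V\<close> it moves \<open>z \<otimes> w\<close> across two factors at once.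
\<close>

definition transport ::
    "('k, 'w, 't) module_scheme \<Rightarrow> ('l \<Rightarrow> 'w \<Rightarrow> 'w) \<Rightarrow> 'w
      \<Rightarrow> (('k \<times> 'l) \<times> ('k \<times> 'l) \<Rightarrow> 'k) set \<Rightarrow> ((('k \<times> 'l) \<times> ('k \<times> 'l) \<Rightarrow> 'k) set \<times> 'w \<Rightarrow> 'k) set" where
  "transport W E t =
     tensor_lift K X X (tensor_product K V W) (\<lambda>z w.
       tensor K V W (tX z w) t
       \<oplus>\<^bsub>tensor_product K V W\<^esub> tensor K V W (tX z one_X) (E (snd w) t)
       \<oplus>\<^bsub>tensor_product K V W\<^esub> tensor K V W (tX one_X w) (E (snd z) t)
       \<oplus>\<^bsub>tensor_product K V W\<^esub> tensor K V W (tX one_X one_X) (E (snd w) (E (snd z) t)))"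

context
  fixes W :: "('k, 'w, 't) module_scheme" and E
  assumes W: "module K W" and E: "bilinear_map K L W W E"
begin

private lemma transport_kernel_linear:
  shows "\<lbrakk>t \<in> carrier W; w \<in> carrier X\<rbrakk> \<Longrightarrow> linear_map K X (tensor_product K V W) (\<lambda>z.
       tensor K V W (tX z w) t
       \<oplus>\<^bsub>tensor_product K V W\<^esub> tensor K V W (tX z one_X) (E (snd w) t)
       \<oplus>\<^bsub>tensor_product K V W\<^esub> tensor K V W (tX one_X w) (E (snd z) t)
       \<oplus>\<^bsub>tensor_product K V W\<^esub> tensor K V W (tX one_X one_X) (E (snd w) (E (snd z) t)))"
    and "\<lbrakk>t \<in> carrier W; z \<in> carrier X\<rbrakk> \<Longrightarrow> linear_map K X (tensor_product K V W) (\<lambda>w.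
       tensor K V W (tX z w) t
       \<oplus>\<^bsub>tensor_product K V W\<^esub> tensor K V W (tX z one_X) (E (snd w) t)
       \<oplus>\<^bsub>tensor_product K V W\<^esub> tensor K V W (tX one_X w) (E (snd z) t)
       \<oplus>\<^bsub>tensor_product K V W\<^esub> tensor K V W (tX one_X one_X) (E (snd w) (E (snd z) t)))"
    and "\<lbrakk>z \<in> carrier X; w \<in> carrier X\<rbrakk> \<Longrightarrow> linear_map K W (tensor_product K V W) (\<lambda>t.
       tensor K V W (tX z w) t
       \<oplus>\<^bsub>tensor_product K V W\<^esub> tensor K V W (tX z one_X) (E (snd w) t)
       \<oplus>\<^bsub>tensor_product K V W\<^esub> tensor K V W (tX one_X w) (E (snd z) t)
       \<oplus>\<^bsub>tensor_product K V W\<^esub> tensor K V W (tX one_X one_X) (E (snd w) (E (snd z) t)))"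
  by (intro linear_map_plus module_tensor_product[OF module_V W]
      bilinear_map_left[OF tensor_bilinear[OF module_V W]]
      bilinear_map_right[OF tensor_bilinear[OF module_V W]]
      tensor_XX_linear bilinear_map_left[OF E] bilinear_map_right[OF E] snd_linear linear_map_ident
      tX_closed one_X_closed bilinear_map_closed[OF E] snd_closed; assumption)+

private lemma transport_kernel_bilinear:
  "t \<in> carrier W \<Longrightarrow> bilinear_map K X X (tensor_product K V W) (\<lambda>z w.
       tensor K V W (tX z w) t
       \<oplus>\<^bsub>tensor_product K V W\<^esub> tensor K V W (tX z one_X) (E (snd w) t)
       \<oplus>\<^bsub>tensor_product K V W\<^esub> tensor K V W (tX one_X w) (E (snd z) t)
       \<oplus>\<^bsub>tensor_product K V W\<^esub> tensor K V W (tX one_X one_X) (E (snd w) (E (snd z) t)))"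
  by (intro bilinear_mapI transport_kernel_linear)

lemma transport_tensor:
  "\<lbrakk>t \<in> carrier W; z \<in> carrier X; w \<in> carrier X\<rbrakk> \<Longrightarrow> transport W E t (tX z w) =
     tensor K V W (tX z w) t
     \<oplus>\<^bsub>tensor_product K V W\<^esub> tensor K V W (tX z one_X) (E (snd w) t)
     \<oplus>\<^bsub>tensor_product K V W\<^esub> tensor K V W (tX one_X w) (E (snd z) t)
     \<oplus>\<^bsub>tensor_product K V W\<^esub> tensor K V W (tX one_X one_X) (E (snd w) (E (snd z) t))"
  unfolding transport_def
  by (rule tensor_lift_tensor[OF module_X module_X module_tensor_product[OF module_V W]
        transport_kernel_bilinear])

lemma transport_bilinear: "bilinear_map K W V (tensor_product K V W) (transport W E)"
  unfolding transport_def[abs_def]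
  by (rule bilinear_mapI)
    (rule tensor_lift_linear[OF module_X module_X module_tensor_product[OF module_V W]
        transport_kernel_bilinear], assumption,
      rule tensor_lift_linear_param[OF module_X module_X module_tensor_product[OF module_V W] W
        transport_kernel_bilinear transport_kernel_linear(3)])

end

section \<open>The operator in closed form\<close>

text \<open>The first factor is any element of \<open>V\<close>, not just a pure tensor of
  \<open>x\<close> and \<open>y\<close>, since the closed form involves it only through the diagonal
  action.\<close>

definition lie_R where
  "lie_R = tensor_lift K V V VV (transport V act_V)"

lemma lie_R_linear: "linear_map K VV VV lie_R"
  unfolding lie_R_def
  by (rule tensor_lift_linear[OF module_V module_V module_VV
        transport_bilinear[OF module_V act_V_bilinear]])

lemma lie_R_tensor:
  "\<lbrakk>v \<in> carrier V; c \<in> carrier V\<rbrakk> \<Longrightarrow> lie_R (tV v c) = transport V act_V v c"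
  unfolding lie_R_def
  by (rule tensor_lift_tensor[OF module_V module_V module_VV
        transport_bilinear[OF module_V act_V_bilinear]])

lemma lie_R_tensor_tensor:
  "\<lbrakk>v \<in> carrier V; z \<in> carrier X; w \<in> carrier X\<rbrakk> \<Longrightarrow> lie_R (tV v (tX z w)) =
     tV (tX z w) v
     \<oplus>\<^bsub>VV\<^esub> tV (tX z one_X) (act_V (snd w) v)
     \<oplus>\<^bsub>VV\<^esub> tV (tX one_X w) (act_V (snd z) v)
     \<oplus>\<^bsub>VV\<^esub> tV (tX one_X one_X) (act_V (snd w) (act_V (snd z) v))"
  by (simp only: lie_R_tensor transport_tensor[OF module_V act_V_bilinear] tX_closed)

text \<open>Each \<open>lie_Delta3\<close> has three terms. Of the nine products, one gives the
  first summand of the closed form, two each give the summands with a single action (one for each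
  leg of the diagonal action), and four give the double action.\<close>

lemma sweedler_sum:
  assumes x: "x \<in> carrier X" and y: "y \<in> carrier X" and z: "z \<in> carrier X" and w: "w \<in> carrier X"
  shows "tensor_lift3 K X X X VV (\<lambda>z1 z2 z3.
      tensor_lift3 K X X X VV (\<lambda>w1 w2 w3.
        tV (tX z1 w1)
          (tX (lie_T K L br (tensor K X V x (tX z2 w2))) (lie_T K L br (tensor K X V y (tX z3 w3)))))
        (lie_Delta3 K L w))
      (lie_Delta3 K L z) = lie_R (tV (tX x y) (tX z w))"
proof -
  let ?F = "\<lambda>z1 z2 z3 w1 w2 w3. tV (tX z1 w1)
    (tX (lie_T K L br (tensor K X V x (tX z2 w2))) (lie_T K L br (tensor K X V y (tX z3 w3))))"
  let ?G = "\<lambda>z1 z2 z3. tensor_lift3 K X X X VV (?F z1 z2 z3) (lie_Delta3 K L w)"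
  interpret XV: module K "tensor_product K X V" by (rule module_tensor_product[OF module_X module_V])
  interpret V: module K V by (rule module_V)
  interpret VV: module K VV by (rule module_VV)
  note closed = tX_closed tV_closed tensor_closed[OF module_X module_V] one_X_closed
    prim_closed snd_closed lie_q_closed linear_map_closed[OF lie_T_linear]
  note linear = tensor_VV_linear tensor_XX_linear tensor_XV_linear linear_map_ident
    linear_map_compose[OF lie_T_linear]
  have Delta3_closed: "lie_Delta3 K L u \<in> carrier (tensor_product K X V)" if "u \<in> carrier X" for u
    using that by (simp add: lie_Delta3_eq closed)
  have F: "trilinear_map K X X X VV (?F z1 z2 z3)"
    if "z1 \<in> carrier X" "z2 \<in> carrier X" "z3 \<in> carrier X" for z1 z2 z3
    using that x y by (intro trilinear_mapI linear closed)
  \<comment> \<open>The outer kernel is an inner sum at the fixed tensor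
    \<open>lie_Delta3 K L w\<close>, so its linearity in each variable is a parameter
    statement.\<close>
  have G: "trilinear_map K X X X VV ?G"
    by (rule trilinear_mapI;
        rule tensor_lift3_linear_param[OF module_X module_X module_X module_VV module_X
          F _ Delta3_closed[OF w]];
        (assumption | (intro linear closed x y; assumption)))
  note lift3 = tensor_lift3_linear[OF module_X module_X module_X module_VV]
    and lift3_tensor = tensor_lift3_tensor[OF module_X module_X module_X module_VV]
  have G_eq: "?G z1 z2 z3 = ?F z1 z2 z3 w one_X one_X \<oplus>\<^bsub>VV\<^esub>
      (?F z1 z2 z3 one_X (prim (snd w)) one_X \<oplus>\<^bsub>VV\<^esub> ?F z1 z2 z3 one_X one_X (prim (snd w)))"
    if "z1 \<in> carrier X" "z2 \<in> carrier X" "z3 \<in> carrier X" for z1 z2 z3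
    using w by (simp add: lie_Delta3_eq linear_map_add[OF lift3[OF F[OF that]]]
        lift3_tensor[OF F[OF that]] closed)
  have "tensor_lift3 K X X X VV ?G (lie_Delta3 K L z) = ?G z one_X one_X \<oplus>\<^bsub>VV\<^esub>
      (?G one_X (prim (snd z)) one_X \<oplus>\<^bsub>VV\<^esub> ?G one_X one_X (prim (snd z)))"
    by (subst lie_Delta3_eq[OF z])
      (simp add: z linear_map_add[OF lift3[OF G]] lift3_tensor[OF G] closed)
  also have "\<dots> = lie_R (tV (tX x y) (tX z w))"
    using x y z w
    by (simp add: G_eq lie_R_tensor_tensor closed lie_T_tensor lie_q_one act_tensor act_closed
        linear_map_add[OF act_V_linear] linear_map_add[OF tensor_VV_linear(2)[OF _ linear_map_ident]]
        V.a_ac VV.a_ac flip: act_X_def)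
  finally show ?thesis .
qed

section \<open>Equivariance of the operator\<close>

lemma snd_act_X: "\<lbrakk>z \<in> carrier X; s \<in> carrier L\<rbrakk> \<Longrightarrow> snd (act_X s z) = br (snd z) s"
  by (auto simp: act_X_def lie_q_def lie_X_simps)

lemma act_X_one: "s \<in> carrier L \<Longrightarrow> act_X s one_X = \<zero>\<^bsub>X\<^esub>"
  unfolding act_X_def by (rule lie_q_one_prim)

lemma act_X_leibniz:
  "\<lbrakk>x \<in> carrier X; t \<in> carrier L; s \<in> carrier L\<rbrakk> \<Longrightarrow>
    act_X s (act_X t x) = act_X t (act_X s x) \<oplus>\<^bsub>X\<^esub> act_X (br t s) x"
  unfolding act_X_def by (rule lie_q_leibniz)

text \<open>On a pure tensor, the mixed terms with \<open>s\<close> on one leg and \<open>t\<close>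
  on the other are the same on both sides; the terms with both on one leg are handled by
  \<open>act_X_leibniz\<close>.\<close>

lemma act_V_leibniz:
  assumes v: "v \<in> carrier V" and t: "t \<in> carrier L" and s: "s \<in> carrier L"
  shows "act_V s (act_V t v) = act_V t (act_V s v) \<oplus>\<^bsub>V\<^esub> act_V (br t s) v"
proof (rule tensor_ext[OF module_X module_X module_V _ _ _ v])
  interpret X: module K X by (rule module_X)
  interpret V: module K V by (rule module_V)
  note lin = act_V_linear[OF t] act_V_linear[OF s] act_V_linear[OF br_closed[OF t s]]
  show "linear_map K V V (\<lambda>v. act_V s (act_V t v))"
    by (rule linear_map_compose[OF lin(2,1)])
  show "linear_map K V V (\<lambda>v. act_V t (act_V s v) \<oplus>\<^bsub>V\<^esub> act_V (br t s) v)"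
    by (rule linear_map_plus[OF module_V linear_map_compose[OF lin(1,2)] lin(3)])
  fix x y assume xy: "x \<in> carrier X" "y \<in> carrier X"
  note closed = s t br_closed act_closed tX_closed
  show "act_V s (act_V t (tX x y)) = act_V t (act_V s (tX x y)) \<oplus>\<^bsub>V\<^esub> act_V (br t s) (tX x y)"
    using xy
    by (simp add: closed act_tensor linear_map_add[OF act_V_linear] act_X_leibniz[OF _ t s]
        linear_map_add[OF tensor_XX_linear(1)[OF linear_map_ident]]
        linear_map_add[OF tensor_XX_linear(2)[OF _ linear_map_ident]] V.a_ac)
qed

text \<open>On the right, moving \<open>s\<close> past the action of the Lie component
  \<open>p\<close> of \<open>z\<close> or \<open>w\<close> creates a term with
  \<open>br p s\<close>. On the left, the same term comes from letting \<open>s\<close> act on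
  \<open>z\<close> or \<open>w\<close>, whose Lie component becomes \<open>br p s\<close>. The units
  in the closed form are annihilated by \<open>s\<close>.\<close>

lemma lie_R_equivariant:
  assumes s: "s \<in> carrier L" and t: "t \<in> carrier VV"
  shows "lie_R (act_VV s t) = act_VV s (lie_R t)"
proof (rule tensor_ext[OF module_V module_V module_VV _ _ _ t])
  interpret X: module K X by (rule module_X)
  interpret V: module K V by (rule module_V)
  interpret VV: module K VV by (rule module_VV)
  note lin = linear_map_compose[OF lie_R_linear act_VV_linear[OF s]]
    linear_map_compose[OF act_VV_linear[OF s] lie_R_linear]
  show "linear_map K VV VV (\<lambda>t. lie_R (act_VV s t))" "linear_map K VV VV (\<lambda>t. act_VV s (lie_R t))"
    by (rule lin)+
  fix v c assume v: "v \<in> carrier V" and c: "c \<in> carrier V"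
  note tV_v = tensor_VV_linear(2)[OF v linear_map_ident]
  show "lie_R (act_VV s (tV v c)) = act_VV s (lie_R (tV v c))"
  proof (rule tensor_ext[OF module_X module_X module_VV
        linear_map_compose[OF lin(1) tV_v] linear_map_compose[OF lin(2) tV_v] _ c])
    fix z w assume zw: "z \<in> carrier X" "w \<in> carrier X"
    have zero: "tX u \<zero>\<^bsub>X\<^esub> = \<zero>\<^bsub>V\<^esub>" "tX \<zero>\<^bsub>X\<^esub> u = \<zero>\<^bsub>V\<^esub>" if "u \<in> carrier X" for u
      using that linear_map_zero[OF module_X module_V] tensor_XX_linear linear_map_ident by metis+
    have zero': "tV \<zero>\<^bsub>V\<^esub> u = \<zero>\<^bsub>VV\<^esub>" if "u \<in> carrier V" for u
      using that linear_map_zero[OF module_V module_VV] tensor_VV_linear linear_map_ident by metis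
    note closed = s v zw br_closed act_closed tX_closed tV_closed snd_closed one_X_closed
    show "lie_R (act_VV s (tV v (tX z w))) = act_VV s (lie_R (tV v (tX z w)))"
      by (simp add: closed act_tensor lie_R_tensor_tensor snd_act_X act_X_one zero zero'
          act_V_leibniz[OF _ _ s]
          linear_map_add[OF lie_R_linear] linear_map_add[OF act_V_linear]
          linear_map_add[OF act_VV_linear]
          linear_map_add[OF tensor_VV_linear(1)[OF linear_map_ident]]
          linear_map_add[OF tensor_VV_linear(2)[OF _ linear_map_ident]] VV.a_ac)
  qed
qed

section \<open>Crossing two factors and the braid equation\<close>

abbreviation "VV_V \<equiv> tensor_product K VV V"
abbreviation "V_VV \<equiv> tensor_product K V VV"
abbreviation "tVV_V \<equiv> tensor K VV V"
abbreviation "tV_VV \<equiv> tensor K V VV"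

lemma module_VV_V: "module K VV_V" and module_V_VV: "module K V_VV"
  by (rule module_tensor_product module_VV module_V)+

text \<open>Every summand of \<open>transport\<close> changes \<open>t\<close> only by iterated
  diagonal actions, with which \<open>lie_R\<close> commutes.\<close>

lemma lie_R_transport:
  assumes t: "t \<in> carrier VV" and c: "c \<in> carrier V"
  shows "tensor_map K V VV V VV id lie_R (transport VV act_VV t c) = transport VV act_VV (lie_R t) c"
proof (rule tensor_ext[OF module_X module_X module_V_VV _ _ _ c])
  interpret V_VV: module K V_VV by (rule module_V_VV)
  note map = tensor_map_linear[OF module_V module_VV module_V module_VV linear_map_id lie_R_linear]
    and map_tensor =
      tensor_map_tensor[OF module_V module_VV module_V module_VV linear_map_id lie_R_linear]
  note bil = transport_bilinear[OF module_VV act_VV_bilinear]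
  note closed = t linear_map_closed[OF lie_R_linear]
  show "linear_map K V V_VV (\<lambda>c. tensor_map K V VV V VV id lie_R (transport VV act_VV t c))"
    by (intro linear_map_compose[OF map] bilinear_map_right[OF bil] linear_map_ident closed)
  show "linear_map K V V_VV (transport VV act_VV (lie_R t))"
    by (intro bilinear_map_right[OF bil] linear_map_ident closed)
  fix z w assume zw: "z \<in> carrier X" "w \<in> carrier X"
  note closed' = closed zw act_closed tX_closed snd_closed one_X_closed
    tensor_closed[OF module_V module_VV]
  show "tensor_map K V VV V VV id lie_R (transport VV act_VV t (tX z w))
      = transport VV act_VV (lie_R t) (tX z w)"
    by (simp add: closed' transport_tensor[OF module_VV act_VV_bilinear] linear_map_add[OF map]
        map_tensor lie_R_equivariant)
qed

text \<open>The defining formula fixes an operator on the carrier of \<open>VV\<close> only; the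
  argument is therefore made for any linear \<open>R\<close> that agrees with \<open>lie_R\<close>
  there.\<close>

context
  fixes R
  assumes R: "linear_map K VV VV R" and R_eq: "\<And>t. t \<in> carrier VV \<Longrightarrow> R t = lie_R t"
begin

private definition "R1 = tensor_map K VV V VV V R id"
private definition "R23 = tensor_map K V VV V VV id R"
private definition "R2 = tensor_assoc_inv K V V V \<circ> R23 \<circ> tensor_assoc K V V V"

private lemmas R1_linear = tensor_map_linear[OF module_VV module_V module_VV module_V R linear_map_id,
    folded R1_def]
  and R23_linear = tensor_map_linear[OF module_V module_VV module_V module_VV linear_map_id R,
    folded R23_def]
  and R1_tensor = tensor_map_tensor[OF module_VV module_V module_VV module_V R linear_map_id,
    folded R1_def, unfolded id_apply]
  and R23_tensor = tensor_map_tensor[OF module_V module_VV module_V module_VV linear_map_id R,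
    folded R23_def, unfolded id_apply]

private lemmas assoc_linear = tensor_assoc_linear[OF module_V module_V module_V]
  and assoc_inv_linear = tensor_assoc_inv_linear[OF module_V module_V module_V]
  and assoc_tensor = tensor_assoc_tensor[OF module_V module_V module_V]
  and assoc_inv_tensor = tensor_assoc_inv_tensor[OF module_V module_V module_V]

private lemma R2_linear: "linear_map K VV_V VV_V R2"
  unfolding R2_def comp_def
  by (intro linear_map_compose[OF assoc_inv_linear] linear_map_compose[OF R23_linear] assoc_linear)

private lemma R23_eq:
  assumes "t \<in> carrier V_VV"
  shows "R23 t = tensor_map K V VV V VV id lie_R t"
  using assms
  by (rule tensor_ext[OF module_V module_VV module_V_VV R23_linear
        tensor_map_linear[OF module_V module_VV module_V module_VV linear_map_id lie_R_linear], rotated])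
    (simp only: R23_tensor R_eq id_apply
      tensor_map_tensor[OF module_V module_VV module_V module_VV linear_map_id lie_R_linear])

private lemma tVV_V_linear:
  "c \<in> carrier V \<Longrightarrow> linear_map K VV VV_V (\<lambda>t. tVV_V t c)"
  "t \<in> carrier VV \<Longrightarrow> linear_map K V VV_V (tVV_V t)"
  using tensor_bilinear[OF module_VV module_V] by (simp_all add: bilinear_map_def)

private lemma tV_VV_linear:
  "c \<in> carrier VV \<Longrightarrow> linear_map K V V_VV (\<lambda>t. tV_VV t c)"
  "t \<in> carrier V \<Longrightarrow> linear_map K VV V_VV (tV_VV t)"
  using tensor_bilinear[OF module_V module_VV] by (simp_all add: bilinear_map_def)

text \<open>\<open>R2\<close> takes \<open>c\<close> past \<open>y\<close>, then \<open>R1\<close>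
  takes it past \<open>x\<close>. For \<open>c\<close> a pure tensor of \<open>z\<close> and
  \<open>w\<close>, the four summands of the first move yield four, two, two and one terms after the
  second. These are the nine terms of the closed form with the diagonal action on a tensor of
  \<open>x\<close> and \<open>y\<close>.\<close>

private lemma crossing:
  assumes t: "t \<in> carrier VV" and c: "c \<in> carrier V"
  shows "R1 (R2 (tVV_V t c)) = tensor_assoc_inv K V V V (transport VV act_VV t c)"
proof (rule tensor_ext[OF module_V module_V module_VV_V _ _ _ t])
  note bil = transport_bilinear[OF module_VV act_VV_bilinear]
  show "linear_map K VV VV_V (\<lambda>t. R1 (R2 (tVV_V t c)))"
    by (intro linear_map_compose[OF R1_linear] linear_map_compose[OF R2_linear] tVV_V_linear c)
  show "linear_map K VV VV_V (\<lambda>t. tensor_assoc_inv K V V V (transport VV act_VV t c))"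
    by (intro linear_map_compose[OF assoc_inv_linear] bilinear_map_left[OF bil] linear_map_ident c)
  fix x y assume xy: "x \<in> carrier V" "y \<in> carrier V"
  show "R1 (R2 (tVV_V (tV x y) c)) = tensor_assoc_inv K V V V (transport VV act_VV (tV x y) c)"
  proof (rule tensor_ext[OF module_X module_X module_VV_V _ _ _ c])
    show "linear_map K V VV_V (\<lambda>c. R1 (R2 (tVV_V (tV x y) c)))"
      by (intro linear_map_compose[OF R1_linear] linear_map_compose[OF R2_linear] tVV_V_linear
          tV_closed xy)
    show "linear_map K V VV_V (\<lambda>c. tensor_assoc_inv K V V V (transport VV act_VV (tV x y) c))"
      by (intro linear_map_compose[OF assoc_inv_linear] bilinear_map_right[OF bil] linear_map_ident
          tV_closed xy)
    fix z w assume zw: "z \<in> carrier X" "w \<in> carrier X"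
    interpret VV: module K VV by (rule module_VV)
    interpret V_VV: module K V_VV by (rule module_V_VV)
    interpret VV_V: module K VV_V by (rule module_VV_V)
    note closed = xy zw act_closed tX_closed tV_closed snd_closed one_X_closed
      tensor_closed[OF module_V module_VV] tensor_closed[OF module_VV module_V]
    \<comment> \<open>A unit left in \<open>c\<close> by the first move has Lie component zero;
      these facts remove the terms in which it would act.\<close>
    note zero = linear_map_zero[OF module_L module_V bilinear_map_left[OF act_V_bilinear linear_map_ident]]
      linear_map_zero[OF module_V module_V act_V_linear]
      linear_map_zero[OF module_V module_VV tensor_VV_linear(2)[OF _ linear_map_ident]]
      linear_map_zero[OF module_VV module_VV_V tVV_V_linear(1)]
    show "R1 (R2 (tVV_V (tV x y) (tX z w)))
        = tensor_assoc_inv K V V V (transport VV act_VV (tV x y) (tX z w))"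
      by (simp add: R2_def closed zero assoc_tensor R23_tensor R1_tensor R_eq lie_R_tensor_tensor
          transport_tensor[OF module_VV act_VV_bilinear] assoc_inv_tensor act_tensor
          linear_map_add[OF assoc_inv_linear] linear_map_add[OF R1_linear]
          linear_map_add[OF act_VV_linear]
          linear_map_add[OF tVV_V_linear(1)] linear_map_add[OF tV_VV_linear(2)] VV_V.a_ac)
  qed
qed

lemma pre_yang_baxter_lie_R: "pre_yang_baxter_operator K V R"
proof -
  note bil = transport_bilinear[OF module_VV act_VV_bilinear]
  \<comment> \<open>The two associators cancel, so on such elements \<open>R2\<close> reduces to the
    right-bracketed \<open>R23\<close>.\<close>
  have R2_inv: "R2 (tensor_assoc_inv K V V V u) = tensor_assoc_inv K V V V (R23 u)"
    if "u \<in> carrier V_VV" for u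
    using that by (simp add: R2_def tensor_assoc_assoc_inv[OF module_V module_V module_V])
  have "R1 (R2 (R1 u)) = R2 (R1 (R2 u))" if u: "u \<in> carrier VV_V" for u
  proof (rule tensor_ext[OF module_VV module_V module_VV_V _ _ _ u])
    show "linear_map K VV_V VV_V (\<lambda>u. R1 (R2 (R1 u)))"
      by (intro linear_map_compose[OF R1_linear] linear_map_compose[OF R2_linear] R1_linear)
    show "linear_map K VV_V VV_V (\<lambda>u. R2 (R1 (R2 u)))"
      by (intro linear_map_compose[OF R2_linear] linear_map_compose[OF R1_linear] R2_linear)
    fix t c assume tc: "t \<in> carrier VV" "c \<in> carrier V"
    have cl: "lie_R t \<in> carrier VV" by (rule linear_map_closed[OF lie_R_linear tc(1)])
    have "R1 (R2 (R1 (tVV_V t c))) = tensor_assoc_inv K V V V (transport VV act_VV (lie_R t) c)"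
      using tc cl by (simp add: R1_tensor R_eq crossing)
    \<comment> \<open>By \<open>lie_R_transport\<close>, acting on the two other factors before the
      crossing becomes acting on them after it.\<close>
    also have "\<dots> = tensor_assoc_inv K V V V (R23 (transport VV act_VV t c))"
      using tc by (simp add: R23_eq lie_R_transport bilinear_map_closed[OF bil])
    also have "\<dots> = R2 (R1 (R2 (tVV_V t c)))"
      using tc by (simp add: R2_inv crossing bilinear_map_closed[OF bil])
    finally show "R1 (R2 (R1 (tVV_V t c))) = R2 (R1 (R2 (tVV_V t c)))" .
  qed
  then show ?thesis
    unfolding pre_yang_baxter_operator_def Let_def
    by (simp add: R flip: R1_def R23_def) (simp add: R2_def)
qed

end

section \<open>Existence and uniqueness of the operator\<close>

text \<open>With the Sweedler sums evaluated by \<open>sweedler_sum\<close>, existence is immediate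
  and uniqueness becomes a question of spanning.\<close>

lemma is_lie_R_iff:
  "is_lie_R K L br R \<longleftrightarrow> linear_map K VV VV R \<and>
    (\<forall>x\<in>carrier X. \<forall>y\<in>carrier X. \<forall>z\<in>carrier X. \<forall>w\<in>carrier X.
      R (tV (tX x y) (tX z w)) = lie_R (tV (tX x y) (tX z w)))"
  unfolding is_lie_R_def Let_def lie_XX_def by (simp only: sweedler_sum cong: ball_cong)

lemma is_lie_R_unique:
  assumes R: "is_lie_R K L br R" and t: "t \<in> carrier VV"
  shows "R t = lie_R t"
proof -
  have lin: "linear_map K VV VV R" using R unfolding is_lie_R_iff by (rule conjunct1)
  have eq: "R (tV (tX x y) (tX z w)) = lie_R (tV (tX x y) (tX z w))"
    if "x \<in> carrier X" "y \<in> carrier X" "z \<in> carrier X" "w \<in> carrier X" for x y z w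
    using R that unfolding is_lie_R_iff by blast
  \<comment> \<open>The agreement is extended one factor at a time: first to arbitrary
    \<open>c\<close> with \<open>x\<close> and \<open>y\<close> fixed, then to arbitrary
    \<open>v\<close>.\<close>
  have eq': "R (tV (tX x y) c) = lie_R (tV (tX x y) c)"
    if x: "x \<in> carrier X" and y: "y \<in> carrier X" and c: "c \<in> carrier V" for x y c
  proof -
    note tV_v = tensor_VV_linear(2)[OF tX_closed[OF x y] linear_map_ident]
    show ?thesis
      by (rule tensor_ext[OF module_X module_X module_VV linear_map_compose[OF lin tV_v]
            linear_map_compose[OF lie_R_linear tV_v] eq[OF x y] c])
  qed
  have "R (tV v c) = lie_R (tV v c)" if v: "v \<in> carrier V" and c: "c \<in> carrier V" for v c
  proof -
    note tV_c = tensor_VV_linear(1)[OF linear_map_ident c]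
    show ?thesis
      by (rule tensor_ext[OF module_X module_X module_VV linear_map_compose[OF lin tV_c]
            linear_map_compose[OF lie_R_linear tV_c] eq'[OF _ _ c] v])
  qed
  then show ?thesis
    by (rule tensor_ext[OF module_V module_V module_VV lin lie_R_linear _ t])
qed

end

text \<open>The existence clause keeps the universal claim from being vacuous; the claim itself
  covers every operator with the prescribed values, whatever it does off the carrier.\<close>

theorem theorem3p2:
  fixes K :: "('k, 'r) ring_scheme" and L :: "('k, 'l, 's) module_scheme"
    and br :: "'l \<Rightarrow> 'l \<Rightarrow> 'l"
  assumes "lie_algebra K L br"
  shows "(\<exists>R. is_lie_R K L br R) \<and>
         (\<forall>R. is_lie_R K L br R \<longrightarrow> pre_yang_baxter_operator K (lie_XX K L) R)"
proof -
  interpret lie_algebra K L br by fact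
  have "is_lie_R K L br lie_R"
    unfolding is_lie_R_iff using lie_R_linear by simp
  moreover have "pre_yang_baxter_operator K V R" if R: "is_lie_R K L br R" for R
  proof (rule pre_yang_baxter_lie_R)
    show "linear_map K VV VV R" using R unfolding is_lie_R_iff by (rule conjunct1)
  qed (rule is_lie_R_unique[OF R])
  ultimately show ?thesis unfolding lie_XX_def by (intro conjI exI allI impI)
qed

end
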